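(* For every integer $d\geq 2$ there is a constant $c=c(d)>0$ such that $$\lim_{n\to\infty}\mathbb{P}\left(\chi\left(G_d(n,c\cdot n^{-1/d})\right)>d\right)=1.$$
   Context: $S^d$ is the unit sphere in $\mathbb{R}^{d+1}$ centred at the origin, and $\operatorname{dist}(u,v)$ is the geodesic distance on $S^d$, i.e. the angle between the vectors $u$ and $v$. The random Borsuk graph $G_d(n,\alpha)$ with parameter $\alpha>0$ has $n$ vertices $X_1,\dots,X_n$, chosen i.i.d. uniformly at random on $S^d$, and for $i\ne j$ an edge $X_iX_j$ if and only if $\operatorname{dist}(X_i,X_j)>\pi-\alpha$. $\chi$ denotes the chromatic number. *)

theory Defs
  imports "HOL-Probability.Probability"
begin

(* The geodesic distance on the unit sphere, as the angle between two nonzero vectors. *)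
definition sphere_dist :: "'a::real_inner \<Rightarrow> 'a \<Rightarrow> real" where
  "sphere_dist u v = arccos ((u \<bullet> v) / (norm u * norm v))"

(* The uniform distribution on the unit sphere, as the law of the direction x / |x| of a point x
   chosen uniformly from the unit ball.  Its value on A is the normalised volume of the cone over A
   (lemma uniform_sphere_cone), which is the normalised surface measure of A.  Removing the
   complement of the sphere (a null set, containing the direction 0 of the centre x = 0) only
   ensures that sampled points always lie on the sphere. *)
definition uniform_sphere :: "'a::euclidean_space measure" where
  "uniform_sphere =
     restrict_space
       (distr (uniform_measure lborel (ball 0 1)) borel (\<lambda>x. x /\<^sub>R norm x))
       (sphere 0 1)"

lemma space_uniform_sphere: "space (uniform_sphere :: 'a::euclidean_space measure) = sphere 0 1"
  by (simp add: uniform_sphere_def space_restrict_space)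

lemma sets_uniform_sphere:
  "sets (uniform_sphere :: 'a::euclidean_space measure) = sets (restrict_space borel (sphere 0 1))"
  by (simp add: uniform_sphere_def sets_restrict_space)

lemma uniform_sphere_cone:
  fixes A :: "'a::euclidean_space set"
  assumes "A \<in> sets borel" "A \<subseteq> sphere 0 1"
  shows "emeasure uniform_sphere A =
    emeasure lborel {r *\<^sub>R u | r u. 0 < r \<and> r < 1 \<and> u \<in> A} / emeasure lborel (ball 0 1 :: 'a set)"
proof -
  let ?p = "\<lambda>x::'a. x /\<^sub>R norm x"
  have meas: "?p \<in> borel_measurable borel"
    by measurable
  have cone: "ball 0 1 \<inter> ?p -` A = {r *\<^sub>R u | r u. 0 < r \<and> r < 1 \<and> u \<in> A}" (is "?L = ?R")
  proof
    show "?L \<subseteq> ?R"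
    proof
      fix x assume x: "x \<in> ?L"
      then have "x \<noteq> 0" using assms(2) by auto
      then show "x \<in> ?R" using x
        by (intro CollectI exI[of _ "norm x"] exI[of _ "?p x"]) auto
    qed
    show "?R \<subseteq> ?L" using assms(2) by auto
  qed
  have "emeasure uniform_sphere A =
      emeasure (distr (uniform_measure lborel (ball 0 1)) borel ?p) A"
    unfolding uniform_sphere_def using assms by (subst emeasure_restrict_space) auto
  also have "\<dots> = emeasure (uniform_measure lborel (ball 0 1)) (?p -` A)"
    using assms(1) meas by (subst emeasure_distr) auto
  also have "\<dots> = emeasure lborel (ball 0 1 \<inter> ?p -` A) / emeasure lborel (ball 0 1 :: 'a set)"
    using measurable_sets[OF meas assms(1)] by (subst emeasure_uniform_measure) auto
  finally show ?thesis by (simp add: cone)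
qed

lemma prob_space_uniform_sphere: "prob_space (uniform_sphere :: 'a::euclidean_space measure)"
proof
  let ?B = "ball 0 1 :: 'a set"
  have eq: "{r *\<^sub>R u | r u. 0 < r \<and> r < 1 \<and> u \<in> sphere 0 (1::real)} = ?B - {0}" (is "?L = _")
  proof
    show "?B - {0} \<subseteq> ?L"
    proof
      fix x assume x: "x \<in> ?B - {0}"
      then show "x \<in> ?L"
        by (intro CollectI exI[of _ "norm x"] exI[of _ "x /\<^sub>R norm x"]) auto
    qed
  qed auto
  have pos: "emeasure lborel ?B \<noteq> 0"
    using content_ball_pos[of 1 "0::'a"] by (auto simp: measure_def)
  have fin: "emeasure lborel ?B \<noteq> \<infinity>"
    using emeasure_lborel_ball_finite[of "0::'a" 1] by auto
  have "emeasure lborel (?B - {0}) = emeasure lborel ?B"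
    by (intro emeasure_Diff_null_set) auto
  then have "emeasure (uniform_sphere :: 'a measure) (sphere 0 1) = 1"
    using pos fin
    by (subst uniform_sphere_cone, simp, simp, subst eq) (simp add: ennreal_divide_self less_top)
  then show "emeasure (uniform_sphere :: 'a measure) (space uniform_sphere) = 1"
    by (simp add: space_uniform_sphere)
qed

(* Graphs are given by a vertex set V and a set E of edges, each edge being a 2-element set. *)
definition proper_colouring :: "'v set \<Rightarrow> 'v set set \<Rightarrow> nat \<Rightarrow> ('v \<Rightarrow> nat) \<Rightarrow> bool" where
  "proper_colouring V E k f \<longleftrightarrow>
     f ` V \<subseteq> {..<k} \<and> (\<forall>u\<in>V. \<forall>v\<in>V. {u, v} \<in> E \<longrightarrow> f u \<noteq> f v)"

(* Intended for finite simple graphs, for which a proper colouring with card V colours exists. *)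
definition chromatic_number :: "'v set \<Rightarrow> 'v set set \<Rightarrow> nat" where
  "chromatic_number V E = (LEAST k. \<exists>f. proper_colouring V E k f)"

(* The Borsuk graph of the points X 1, ..., X n; the vertex X i is represented by its index i. *)
definition borsuk_edges :: "nat \<Rightarrow> real \<Rightarrow> (nat \<Rightarrow> 'a::real_inner) \<Rightarrow> nat set set" where
  "borsuk_edges n \<alpha> X =
     {{i, j} | i j. i \<in> {1..n} \<and> j \<in> {1..n} \<and> i \<noteq> j \<and> sphere_dist (X i) (X j) > pi - \<alpha>}"

(* The law of n independent uniformly distributed points X 1, ..., X n on the unit sphere. *)
definition iid_sphere :: "nat \<Rightarrow> (nat \<Rightarrow> 'a::euclidean_space) measure" where
  "iid_sphere n = (\<Pi>\<^sub>M i\<in>{1..n}. uniform_sphere)"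

end

theory Submission
  imports Defs "HOL-Library.Z2" "HOL-Real_Asymp.Real_Asymp"
begin

text \<open>Divide the sphere into about $m^d$ cells, the radial projections of cubical cells on the
  boundary of $[-m,m]^{d+1}$, where $m^d$ is a small multiple of \<open>n\<close>. Call a cell bad if it or its
  antipode contains no sample point. A proper colouring with \<open>d\<close> colours yields, by Tucker's
  lemma, a path of adjacent bad cells joining some cell to its antipode. Such a path has at least
  \<open>m\<close> cells. There are at most $(2m+1)^{d+1} K^m$ candidate paths, and each of them is bad
  with probability at most $e^{-c m}$, with \<open>c\<close> as large as we please. Tucker's lemma in turn is
  proved by Fan's parity argument, with chains modulo 2 represented by their action on cochains.\<close>

section \<open>Cochains modulo 2 and prism operators\<close>

text \<open>As n / m^d tends to a constant \<open>M\<close>, empty cells have to be reckoned with,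
  so the topological argument cannot assume that every cell is occupied. The bad cells are given the
  label pair +-d for themselves, and this costs one colour: without bad cells, d + 1 colours would
  still give labels in +-{1, ..., d} and be excluded in the same way. The probabilistic side
  balances two exponentials: paths branch by a factor depending only on d, while each further cell
  lowers the probability by a factor that is exponentially small in n / m^d; enlarging
  \<open>M\<close>, hence c, makes the second one win. Instead of a triangulation of the grid, all
  lists of pairwise adjacent vertices serve as simplices, degenerate ones included. With chains
  given as functionals on cochains, the boundary of a chain is its composition with
  \<open>coboundary\<close>.\<close>

declare add_bit_eq_xor [simp del]
  Z2.bit_not_zero_iff [simp del] Z2.bit_not_one_iff [simp del]

text \<open>Unfolded, the sum of the values on all lists obtained by dropping one entry; modulo 2
  there are no signs. The empty list is the face of a single vertex, so the complex is
  augmented.\<close>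

fun coboundary :: "('v list \<Rightarrow> bit) \<Rightarrow> 'v list \<Rightarrow> bit" where
  "coboundary \<phi> [] = 0"
| "coboundary \<phi> (v # \<sigma>) = \<phi> \<sigma> + coboundary (\<lambda>\<tau>. \<phi> (v # \<tau>)) \<sigma>"

text \<open>Dual of the classical prism operator: the terms are the values on f v0, ..., f vi, g vi,
  ..., g vk, which together fill the prism between the two images of the simplex.\<close>

fun prism :: "('v \<Rightarrow> 'w) \<Rightarrow> ('v \<Rightarrow> 'w) \<Rightarrow> ('w list \<Rightarrow> bit) \<Rightarrow> 'v list \<Rightarrow> bit" where
  "prism f g \<phi> [] = 0"
| "prism f g \<phi> (v # \<sigma>) =
     \<phi> (f v # g v # map g \<sigma>) + prism f g (\<lambda>\<tau>. \<phi> (f v # \<tau>)) \<sigma>"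

lemma coboundary_map: "coboundary (\<lambda>\<tau>. \<phi> (map f \<tau>)) \<sigma> = coboundary \<phi> (map f \<sigma>)"
  by (induction \<sigma> arbitrary: \<phi>) auto

lemma coboundary_add:
  "coboundary (\<lambda>\<tau>. \<phi> \<tau> + \<psi> \<tau>) \<sigma> = coboundary \<phi> \<sigma> + coboundary \<psi> \<sigma>"
  by (induction \<sigma> arbitrary: \<phi> \<psi>) (auto simp: add_ac)

lemma coboundary_zero: "coboundary (\<lambda>\<tau>. 0) \<sigma> = 0"
  by (induction \<sigma>) auto

lemma coboundary_sum:
  "finite A \<Longrightarrow> coboundary (\<lambda>\<tau>. \<Sum>t\<in>A. \<phi> t \<tau>) \<sigma> = (\<Sum>t\<in>A. coboundary (\<phi> t) \<sigma>)"
  by (induction A rule: finite_induct) (simp_all add: coboundary_add coboundary_zero)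

lemma prism_add:
  "prism f g (\<lambda>\<tau>. \<phi> \<tau> + \<psi> \<tau>) \<sigma> = prism f g \<phi> \<sigma> + prism f g \<psi> \<sigma>"
  by (induction \<sigma> arbitrary: \<phi> \<psi>) (auto simp: add_ac)

lemma bit_add_cancel: "(a::bit) + (a + b) = b"
  by (cases a; cases b) auto

text \<open>Chain homotopy between f and g. In the inductive step the term
  \<open>\<phi> (f v # map g \<sigma>)\<close> arises twice, as a face of the first prism simplex
  and from the induction hypothesis, and cancels.\<close>

lemma prism_coboundary:
  "prism f g (coboundary \<phi>) \<sigma> =
     coboundary (prism f g \<phi>) \<sigma> + \<phi> (map f \<sigma>) + \<phi> (map g \<sigma>)"
proof (induction \<sigma> arbitrary: \<phi>)
  case Nil
  then show ?case by simp
next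
  case (Cons v \<sigma>)
  show ?case
    by (simp add: coboundary_add prism_add Cons.IH coboundary_map
        [where \<phi> = "\<lambda>\<tau>. \<phi> (f v # g v # \<tau>)"] add_ac bit_add_cancel)
qed

lemma prism_cong:
  assumes "\<And>\<tau>. length \<tau> = Suc (length \<sigma>) \<Longrightarrow> set \<tau> \<subseteq> f ` set \<sigma> \<union> g ` set \<sigma> \<Longrightarrow> \<phi> \<tau> = \<psi> \<tau>"
  shows "prism f g \<phi> \<sigma> = prism f g \<psi> \<sigma>"
  using assms
proof (induction \<sigma> arbitrary: \<phi> \<psi>)
  case Nil
  then show ?case by simp
next
  case (Cons v \<sigma>)
  have "\<phi> (f v # g v # map g \<sigma>) = \<psi> (f v # g v # map g \<sigma>)"
    by (rule Cons.prems) auto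
  moreover have "prism f g (\<lambda>\<tau>. \<phi> (f v # \<tau>)) \<sigma> = prism f g (\<lambda>\<tau>. \<psi> (f v # \<tau>)) \<sigma>"
    by (rule Cons.IH, rule Cons.prems) auto
  ultimately show ?case by simp
qed

section \<open>Hemispheres in the grid\<close>

definition grid_sphere :: "nat \<Rightarrow> nat \<Rightarrow> (nat \<Rightarrow> int) set" where
  "grid_sphere k m =
     {v. (\<forall>i>k. v i = 0) \<and> (\<forall>i. \<bar>v i\<bar> \<le> int m) \<and> (\<exists>i\<le>k. \<bar>v i\<bar> = int m)}"

definition adjacent :: "(nat \<Rightarrow> int) \<Rightarrow> (nat \<Rightarrow> int) \<Rightarrow> bool" where
  "adjacent v w \<longleftrightarrow> (\<forall>i. \<bar>v i - w i\<bar> \<le> 1)"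

text \<open>Repeated vertices are allowed because neighbouring stages of a sweep may agree at a
  vertex, so that prism terms can be degenerate.\<close>

definition grid_simplices :: "nat \<Rightarrow> nat \<Rightarrow> (nat \<Rightarrow> int) list set" where
  "grid_simplices k m =
     {\<sigma>. length \<sigma> = Suc k \<and> set \<sigma> \<subseteq> grid_sphere k m \<and>
        (\<forall>v\<in>set \<sigma>. \<forall>w\<in>set \<sigma>. adjacent v w)}"

definition antipode :: "(nat \<Rightarrow> int) \<Rightarrow> nat \<Rightarrow> int" where
  "antipode v = (\<lambda>i. - v i)"

lemma antipode_antipode [simp]: "antipode (antipode v) = v"
  by (simp add: antipode_def)

lemma antipode_in_grid_sphere [simp]: "antipode v \<in> grid_sphere k m \<longleftrightarrow> v \<in> grid_sphere k m"
  by (simp add: antipode_def grid_sphere_def)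

lemma adjacent_antipode [simp]: "adjacent (antipode v) (antipode w) \<longleftrightarrow> adjacent v w"
  by (simp add: adjacent_def antipode_def abs_minus_commute)

lemma adjacent_refl [simp]: "adjacent v v"
  by (simp add: adjacent_def)

lemma adjacent_sym: "adjacent v w \<Longrightarrow> adjacent w v"
  by (simp add: adjacent_def abs_minus_commute)

lemma map_antipode_in_grid_simplices:
  "\<sigma> \<in> grid_simplices k m \<Longrightarrow> map antipode \<sigma> \<in> grid_simplices k m"
  by (auto simp: grid_simplices_def)

section \<open>Sweeping a sphere across the next hemisphere\<close>

definition clamp :: "int \<Rightarrow> int \<Rightarrow> int" where
  "clamp r x = max (- r) (min r x)"

lemma abs_clamp_le: "0 \<le> r \<Longrightarrow> \<bar>clamp r x\<bar> \<le> r"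
  by (simp add: clamp_def)

lemma clamp_id: "\<bar>x\<bar> \<le> r \<Longrightarrow> clamp r x = x"
  by (simp add: clamp_def)

lemma clamp_0 [simp]: "0 \<le> r \<Longrightarrow> clamp r 0 = 0" "clamp 0 x = 0"
  by (simp_all add: clamp_def)

lemma clamp_close: "\<bar>r - s\<bar> \<le> 1 \<Longrightarrow> \<bar>x - y\<bar> \<le> 1 \<Longrightarrow> \<bar>clamp r x - clamp s y\<bar> \<le> 1"
  unfolding clamp_def by linarith

text \<open>For $t \le m$ the \<open>k\<close>-sphere is pushed up along the new coordinate; for
  $m \le t \le 2m$ it is contracted, inside the top face, to the centre of that face.\<close>
definition sweep :: "nat \<Rightarrow> nat \<Rightarrow> nat \<Rightarrow> (nat \<Rightarrow> int) \<Rightarrow> nat \<Rightarrow> int" where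
  "sweep k m t v =
     (\<lambda>i. if i = Suc k then int (min t m)
          else clamp (int (min m (2 * m - t))) (v i))"

text \<open>A chain is represented by the values it gives to cochains. Sweeping the cycle formed by the
  \<open>k\<close>-hemisphere and its antipode gives the next hemisphere.\<close>
primrec hemisphere :: "nat \<Rightarrow> nat \<Rightarrow> ((nat \<Rightarrow> int) list \<Rightarrow> bit) \<Rightarrow> bit" where
  "hemisphere m 0 \<phi> = \<phi> [\<lambda>i. if i = 0 then int m else 0]"
| "hemisphere m (Suc k) \<phi> =
     hemisphere m k (\<lambda>\<sigma>. \<Sum>t<2*m. prism (sweep k m t) (sweep k m (Suc t)) \<phi> \<sigma>) +
     hemisphere m k (\<lambda>\<sigma>. \<Sum>t<2*m. prism (sweep k m t) (sweep k m (Suc t)) \<phi> (map antipode \<sigma>))"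

text \<open>Up to time \<open>m\<close> the clamp radius is \<open>m\<close>, so a coordinate of
  modulus \<open>m\<close> survives; afterwards the new coordinate has this modulus.\<close>

lemma sweep_in_grid_sphere:
  assumes "v \<in> grid_sphere k m" shows "sweep k m t v \<in> grid_sphere (Suc k) m"
proof -
  have "\<bar>clamp (int (min m (2 * m - t))) x\<bar> \<le> int m" for x
    by (rule order_trans[OF abs_clamp_le]) auto
  then have "\<forall>i>Suc k. sweep k m t v i = 0" "\<forall>i. \<bar>sweep k m t v i\<bar> \<le> int m"
    using assms by (simp_all add: sweep_def grid_sphere_def)
  moreover have "\<exists>i\<le>Suc k. \<bar>sweep k m t v i\<bar> = int m"
  proof (cases "t \<le> m")
    case True
    from assms obtain i where i: "i \<le> k" "\<bar>v i\<bar> = int m"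
      by (auto simp: grid_sphere_def)
    then have "sweep k m t v i = v i"
      using True by (simp add: sweep_def clamp_id)
    then show ?thesis
      using i by (intro exI[of _ i]) auto
  next
    case False
    then have "\<bar>sweep k m t v (Suc k)\<bar> = int m"
      by (simp add: sweep_def)
    then show ?thesis by blast
  qed
  ultimately show ?thesis
    unfolding grid_sphere_def by blast
qed

lemma adjacent_sweep:
  assumes "adjacent v w" "s \<le> Suc t" "t \<le> Suc s"
  shows "adjacent (sweep k m s v) (sweep k m t w)"
  unfolding adjacent_def
proof
  fix i
  have "\<bar>v i - w i\<bar> \<le> 1" using assms by (simp add: adjacent_def)
  moreover have "\<bar>int (min m (2 * m - s)) - int (min m (2 * m - t))\<bar> \<le> 1"
    using assms(2,3) by linarith
  ultimately have "\<bar>clamp (int (min m (2 * m - s))) (v i) - clamp (int (min m (2 * m - t))) (w i)\<bar> \<le> 1"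
    by (intro clamp_close)
  moreover have "\<bar>int (min s m) - int (min t m)\<bar> \<le> 1"
    using assms(2,3) by linarith
  ultimately show "\<bar>sweep k m s v i - sweep k m t w i\<bar> \<le> 1"
    by (simp add: sweep_def)
qed

lemma prism_sweep_cong:
  assumes eq: "\<And>\<sigma>. \<sigma> \<in> grid_simplices (Suc k) m \<Longrightarrow> \<phi> \<sigma> = \<psi> \<sigma>"
    and \<sigma>: "\<sigma> \<in> grid_simplices k m"
  shows "prism (sweep k m t) (sweep k m (Suc t)) \<phi> \<sigma> = prism (sweep k m t) (sweep k m (Suc t)) \<psi> \<sigma>"
proof (rule prism_cong, rule eq)
  fix \<tau> assume "length \<tau> = Suc (length \<sigma>)"
    and sub: "set \<tau> \<subseteq> sweep k m t ` set \<sigma> \<union> sweep k m (Suc t) ` set \<sigma>"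
  moreover have "set \<tau> \<subseteq> grid_sphere (Suc k) m"
    using sub \<sigma> by (force simp: grid_simplices_def intro: sweep_in_grid_sphere)
  moreover have "adjacent v w" if vw: "v \<in> set \<tau>" "w \<in> set \<tau>" for v w
  proof -
    obtain a s where a: "v = sweep k m s a" "a \<in> set \<sigma>" "s \<in> {t, Suc t}"
      using sub vw by blast
    obtain b r where b: "w = sweep k m r b" "b \<in> set \<sigma>" "r \<in> {t, Suc t}"
      using sub vw by blast
    show ?thesis
      unfolding a(1) b(1) using a(2,3) b(2,3) \<sigma>
      by (intro adjacent_sweep) (auto simp: grid_simplices_def)
  qed
  ultimately show "\<tau> \<in> grid_simplices (Suc k) m"
    using \<sigma> by (auto simp: grid_simplices_def)
qed

text \<open>The chain is supported on grid simplices. Identities that rely on the absence of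
  complementary edges hold only there.\<close>

lemma hemisphere_cong:
  assumes "\<And>\<sigma>. \<sigma> \<in> grid_simplices k m \<Longrightarrow> \<phi> \<sigma> = \<psi> \<sigma>"
  shows "hemisphere m k \<phi> = hemisphere m k \<psi>"
  using assms
proof (induction k arbitrary: \<phi> \<psi>)
  case 0
  then show ?case by (auto simp: grid_simplices_def grid_sphere_def)
next
  case (Suc k)
  show ?case
    unfolding hemisphere.simps
    by (intro arg_cong2[where f = "(+)"] Suc.IH sum.cong refl prism_sweep_cong Suc.prems
        map_antipode_in_grid_simplices)
qed

lemma hemisphere_add: "hemisphere m k (\<lambda>\<sigma>. \<phi> \<sigma> + \<psi> \<sigma>) = hemisphere m k \<phi> + hemisphere m k \<psi>"
  by (induction k arbitrary: \<phi> \<psi>) (simp_all add: prism_add sum.distrib add_ac)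

lemma bit_double: "(a::bit) + a = 0"
  by (cases a) auto


lemma telescope_bit: "(\<Sum>t<n. (a t :: bit) + a (Suc t)) = a 0 + a n"
  by (induction n) (auto simp: add_ac bit_double bit_add_cancel)

text \<open>Pattern of the next computation: a and b are coboundary terms, x and y the starts of the
  two sweeps, and c is their common end.\<close>

lemma bit_cancel_pair: "(a::bit) + b = 0 \<Longrightarrow> (a + (x + c)) + (b + (y + c)) = x + y"
  by (cases a; cases b; cases x; cases y; cases c) auto

lemma sweep_0: "v \<in> grid_sphere k m \<Longrightarrow> sweep k m 0 v = v"
proof
  fix i
  assume "v \<in> grid_sphere k m"
  then have "\<bar>v i\<bar> \<le> int m" "i > k \<Longrightarrow> v i = 0"
    by (auto simp: grid_sphere_def)
  then show "sweep k m 0 v i = v i"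
    by (cases "i = Suc k") (simp_all add: sweep_def clamp_id)
qed

lemma sweep_final: "sweep k m (2 * m) v = sweep k m (2 * m) w"
  by (auto simp: sweep_def fun_eq_iff)

text \<open>As the swept chain is a cycle, only the start and the end of the sweep contribute. At
  time \<open>2 * m\<close> every vertex has reached the centre of the top face, so a simplex and
  its antipode end alike and the ends cancel modulo 2.\<close>

lemma hemisphere_coboundary_step:
  assumes cycle: "\<And>\<psi>. hemisphere m k (coboundary \<psi>) +
      hemisphere m k (coboundary (\<lambda>\<sigma>. \<psi> (map antipode \<sigma>))) = 0"
  shows "hemisphere m (Suc k) (coboundary \<phi>) =
     hemisphere m k \<phi> + hemisphere m k (\<lambda>\<sigma>. \<phi> (map antipode \<sigma>))"
proof -
  define \<Phi> where "\<Phi> \<sigma> = (\<Sum>t<2*m. prism (sweep k m t) (sweep k m (Suc t)) \<phi> \<sigma>)" for \<sigma>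
  define c where "c \<sigma> = \<phi> (map (sweep k m (2 * m)) \<sigma>)" for \<sigma>
  have "map (sweep k m (2 * m)) (map antipode \<sigma>) = map (sweep k m (2 * m)) \<sigma>" for \<sigma>
    by (auto intro: sweep_final)
  then have c: "c (map antipode \<sigma>) = c \<sigma>" for \<sigma>
    unfolding c_def by metis
  have sum: "(\<Sum>t<2*m. prism (sweep k m t) (sweep k m (Suc t)) (coboundary \<phi>) \<sigma>) =
      coboundary \<Phi> \<sigma> + (\<phi> \<sigma> + c \<sigma>)" if "\<sigma> \<in> grid_simplices k m" for \<sigma>
  proof -
    have "map (sweep k m 0) \<sigma> = \<sigma>"
      using that by (intro map_idI sweep_0) (auto simp: grid_simplices_def)
    then have "(\<Sum>t<2*m. \<phi> (map (sweep k m t) \<sigma>) + \<phi> (map (sweep k m (Suc t)) \<sigma>)) = \<phi> \<sigma> + c \<sigma>"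
      by (simp only: telescope_bit[where a = "\<lambda>t. \<phi> (map (sweep k m t) \<sigma>)"] c_def)
    then show ?thesis
      unfolding prism_coboundary \<Phi>_def
      by (simp add: coboundary_sum sum.distrib add.assoc)
  qed
  have "hemisphere m (Suc k) (coboundary \<phi>) =
      hemisphere m k (\<lambda>\<sigma>. coboundary \<Phi> \<sigma> + (\<phi> \<sigma> + c \<sigma>)) +
      hemisphere m k (\<lambda>\<sigma>. coboundary (\<lambda>\<tau>. \<Phi> (map antipode \<tau>)) \<sigma> + (\<phi> (map antipode \<sigma>) + c \<sigma>))"
    unfolding hemisphere.simps
    by (intro arg_cong2[where f = "(+)"] hemisphere_cong)
      (simp_all add: sum map_antipode_in_grid_simplices coboundary_map c)
  then show ?thesis
    using cycle[of \<Phi>] by (simp only: hemisphere_add bit_cancel_pair)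
qed

text \<open>In dimension 0 both terms are the value on the empty list. Higher up, the boundary is
  the previous hemisphere plus its antipode, and the antipodal map merely swaps the two.\<close>

lemma hemisphere_cycle:
  "hemisphere m k (coboundary \<psi>) + hemisphere m k (coboundary (\<lambda>\<sigma>. \<psi> (map antipode \<sigma>))) = 0"
proof (induction k arbitrary: \<psi>)
  case 0
  then show ?case by (simp add: bit_double)
next
  case (Suc k)
  show ?case
    by (simp add: hemisphere_coboundary_step[OF Suc.IH] o_def add_ac bit_double bit_add_cancel
        del: hemisphere.simps)
qed

lemmas hemisphere_coboundary = hemisphere_coboundary_step[OF hemisphere_cycle]

section \<open>Tucker's lemma\<close>

text \<open>Parity plays the role of the sign, and \<open>s\<close> says whether the first label is
  positive. Equal labels become neighbours after sorting, so a simplex with a repeated label gets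
  the value 0.\<close>

fun alternating :: "bool \<Rightarrow> nat list \<Rightarrow> bit" where
  "alternating s [] = 1"
| "alternating s (x # xs) = (if even x = s then alternating (\<not> s) xs else 0)"

text \<open>The parity count of Fan. An alternating list has one alternating face starting with each
  sign, by dropping its first or its last entry. A list that does not alternate has either no such
  face or, when exactly one neighbouring pair has equal signs, two faces that start alike, by
  dropping either member of the pair.\<close>

lemma coboundary_alternating:
  "xs \<noteq> [] \<Longrightarrow> coboundary (alternating s) xs = alternating s xs + alternating (\<not> s) xs"
proof (induction xs arbitrary: s)
  case (Cons x xs)
  then show ?case
    by (cases "xs = []"; cases "even x = s") (auto simp: add_ac bit_add_cancel coboundary_zero)
qed simp

lemma coboundary_symmetric:
  assumes "\<And>xs. \<phi> xs = g (mset xs)"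
  shows "coboundary \<phi> xs = (\<Sum>x\<in>#mset xs. g (mset xs - {#x#}))"
  using assms
proof (induction xs arbitrary: \<phi> g)
  case (Cons v xs)
  have "coboundary (\<lambda>\<tau>. \<phi> (v # \<tau>)) xs = (\<Sum>x\<in>#mset xs. g (add_mset v (mset xs - {#x#})))"
    by (rule Cons.IH) (simp add: Cons.prems)
  also have "\<dots> = (\<Sum>x\<in>#mset xs. g (mset (v # xs) - {#x#}))"
    by (intro arg_cong[where f = sum_mset] image_mset_cong) auto
  finally show ?case by (simp add: Cons.prems)
qed simp

lemma coboundary_cong_sublist:
  assumes "\<And>ys. set ys \<subseteq> set xs \<Longrightarrow> sorted ys \<Longrightarrow> \<phi> ys = \<psi> ys" "sorted xs"
  shows "coboundary \<phi> xs = coboundary \<psi> xs"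
  using assms
proof (induction xs arbitrary: \<phi> \<psi>)
  case (Cons x xs)
  have "coboundary (\<lambda>\<tau>. \<phi> (x # \<tau>)) xs = coboundary (\<lambda>\<tau>. \<psi> (x # \<tau>)) xs"
    using Cons.prems by (intro Cons.IH Cons.prems(1)) auto
  moreover have "\<phi> xs = \<psi> xs"
    using Cons.prems by (intro Cons.prems(1)) auto
  ultimately show ?case by simp
qed simp

text \<open>Dropping an entry before or after sorting leaves the same multisets, so both sides sum
  the same values; faces of a sorted list are already sorted.\<close>

lemma coboundary_sort:
  "coboundary (\<lambda>ys. \<phi> (sort ys)) xs = coboundary \<phi> (sort xs)" for xs :: "nat list"
proof -
  have *: "\<phi> (sort ys) = \<phi> (sorted_list_of_multiset (mset ys))" for ys
    by simp
  have "coboundary (\<lambda>ys. \<phi> (sort ys)) xs = coboundary (\<lambda>ys. \<phi> (sort ys)) (sort xs)"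
    by (simp only: coboundary_symmetric[where g = "\<lambda>M. \<phi> (sorted_list_of_multiset M)", OF *] mset_sort)
  also have "\<dots> = coboundary \<phi> (sort xs)"
    by (rule coboundary_cong_sublist) (auto simp: sorted_sort_id)
  finally show ?thesis .
qed

text \<open>The labels $2i$ and $2i+1$ stand for $i+1$ and $-(i+1)$, and \<open>flip\<close> is negation.\<close>
definition flip :: "nat \<Rightarrow> nat" where
  "flip x = (if even x then Suc x else x - 1)"

lemma even_flip [simp]: "even (flip x) \<longleftrightarrow> odd x"
  by (auto simp: flip_def)

lemma alternating_map_flip: "alternating s (map flip xs) = alternating (\<not> s) xs"
  by (induction xs arbitrary: s) auto

text \<open>Negation moves labels only within the pairs 2i, 2i+1, so it can reverse the order of
  complementary labels only.\<close>

lemma flip_mono: "x \<le> y \<Longrightarrow> y \<noteq> flip x \<Longrightarrow> flip x \<le> flip y"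
  by (auto simp: flip_def elim!: oddE evenE split: if_splits)

lemma sort_map_flip:
  assumes "\<And>x y. x \<in> set xs \<Longrightarrow> y \<in> set xs \<Longrightarrow> y \<noteq> flip x"
  shows "sort (map flip xs) = map flip (sort xs)"
proof (rule properties_for_sort)
  show "sorted (map flip (sort xs))"
    unfolding sorted_map using assms
    by (intro sorted_wrt_mono_rel[OF _ sorted_sort[of xs]])
       (auto intro: flip_mono)
qed simp

text \<open>A change of sign rules out equal neighbours, and the absence of complementary labels
  then rules out equal absolute values. So each entry uses up one of the \<open>b - a\<close>
  pairs.\<close>

lemma alternating_sorted_bound:
  assumes "alternating s xs \<noteq> 0" "sorted xs"
    and "\<And>x y. x \<in> set xs \<Longrightarrow> y \<in> set xs \<Longrightarrow> y \<noteq> flip x"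
    and "\<And>x. x \<in> set xs \<Longrightarrow> 2 * a \<le> x \<and> x < 2 * b"
  shows "length xs \<le> b - a"
  using assms
proof (induction xs arbitrary: s a)
  case (Cons x xs)
  have "length xs \<le> b - Suc (x div 2)"
  proof (rule Cons.IH)
    show alt: "alternating (\<not> s) xs \<noteq> 0" 
      using Cons.prems(1) by (auto split: if_splits)
    show "sorted xs" using Cons.prems by auto
    show "2 * Suc (x div 2) \<le> y \<and> y < 2 * b" if y: "y \<in> set xs" for y
    proof -
      obtain z zs where xs: "xs = z # zs" using y by (cases xs) auto
      have "even z \<noteq> even x"
        using alt Cons.prems(1) xs by (auto split: if_splits)
      moreover have "x \<le> z" "z \<le> y" using Cons.prems(2) y xs by auto
      moreover have "z \<noteq> flip x" using Cons.prems(3)[of x z] xs by auto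
      ultimately have "2 * Suc (x div 2) \<le> y"
        by (auto simp: flip_def elim!: evenE oddE split: if_splits) presburger
      then show ?thesis using Cons.prems(4)[of y] y by auto
    qed
  qed (use Cons.prems(3) in auto)
  then show ?case using Cons.prems(4)[of x] by auto
qed simp

text \<open>Without a complementary edge, the number of alternating simplices of either sign in the
  k-hemisphere is odd for all k up to d. But the d + 1 labels of a d-simplex cannot alternate using
  d absolute values.\<close>

theorem tucker_grid:
  assumes flip: "\<And>v. v \<in> grid_sphere d m \<Longrightarrow> lab (antipode v) = flip (lab v)"
    and less: "\<And>v. v \<in> grid_sphere d m \<Longrightarrow> lab v < 2 * d"
  obtains v w where "v \<in> grid_sphere d m" "w \<in> grid_sphere d m" "adjacent v w" "lab w = flip (lab v)"
proof (rule ccontr)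
  assume "\<not> thesis"
  with that have no: "lab w \<noteq> flip (lab v)"
    if "v \<in> grid_sphere d m" "w \<in> grid_sphere d m" "adjacent v w" for v w
    using that by blast
  define \<phi> where "\<phi> s \<sigma> = alternating s (sort (map lab \<sigma>))" for s \<sigma>
  have sub: "v \<in> grid_sphere d m" if "v \<in> grid_sphere k m" "k \<le> d" for v k
  proof -
    from that obtain i where "i \<le> k" "\<bar>v i\<bar> = int m" by (auto simp: grid_sphere_def)
    then have "\<exists>i\<le>d. \<bar>v i\<bar> = int m" using \<open>k \<le> d\<close> by (intro exI[of _ i]) auto
    then show ?thesis using that by (simp add: grid_sphere_def)
  qed
  have no': "y \<noteq> flip x" if "k \<le> d" "\<sigma> \<in> grid_simplices k m" "x \<in> set (map lab \<sigma>)" "y \<in> set (map lab \<sigma>)" for \<sigma> k x y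
  proof -
    obtain v w where "v \<in> set \<sigma>" "w \<in> set \<sigma>" "x = lab v" "y = lab w" using \<open>x \<in> _\<close> \<open>y \<in> _\<close> by auto
    moreover have "v \<in> grid_sphere d m" "w \<in> grid_sphere d m" "adjacent v w"
      using \<open>v \<in> set \<sigma>\<close> \<open>w \<in> set \<sigma>\<close> that(1,2) by (auto simp: grid_simplices_def subset_iff intro: sub)
    ultimately show ?thesis using no by simp
  qed
  \<comment> \<open>Negating all labels commutes with sorting as no two of them are complementary,
    and it exchanges the starting signs.\<close>
  have neg: "\<phi> True (map antipode \<sigma>) = \<phi> False \<sigma>" if "k \<le> d" "\<sigma> \<in> grid_simplices k m" for k \<sigma>
  proof -
    have "map lab (map antipode \<sigma>) = map flip (map lab \<sigma>)"
      using that(2) flip sub[OF _ that(1)] by (simp add: grid_simplices_def subset_iff)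
    then have "sort (map lab (map antipode \<sigma>)) = map flip (sort (map lab \<sigma>))"
      using sort_map_flip[of "map lab \<sigma>"] no'[OF that] by metis
    then show ?thesis by (simp add: \<phi>_def alternating_map_flip del: map_map)
  qed
  have cob: "coboundary (\<phi> True) \<sigma> = \<phi> True \<sigma> + \<phi> False \<sigma>" if "\<sigma> \<noteq> []" for \<sigma>
  proof -
    have "coboundary (\<phi> True) \<sigma> = coboundary (\<lambda>ys. alternating True (sort ys)) (map lab \<sigma>)"
      unfolding \<phi>_def by (rule coboundary_map)
    also have "\<dots> = coboundary (alternating True) (sort (map lab \<sigma>))"
      by (rule coboundary_sort)
    also have "\<dots> = \<phi> True \<sigma> + \<phi> False \<sigma>"
      using that by (subst coboundary_alternating) (auto simp: \<phi>_def simp flip: set_empty)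
    finally show ?thesis .
  qed
  have one: "hemisphere m k (\<lambda>\<sigma>. \<phi> True \<sigma> + \<phi> False \<sigma>) = 1" if "k \<le> d" for k
    using that
  proof (induction k)
    case 0
    show ?case by (simp add: \<phi>_def)
  next
    case (Suc k)
    have "hemisphere m (Suc k) (\<lambda>\<sigma>. \<phi> True \<sigma> + \<phi> False \<sigma>) = hemisphere m (Suc k) (coboundary (\<phi> True))"
      by (rule hemisphere_cong, subst cob) (auto simp: grid_simplices_def)
    also have "\<dots> = hemisphere m k (\<phi> True) + hemisphere m k (\<lambda>\<sigma>. \<phi> True (map antipode \<sigma>))"
      by (rule hemisphere_coboundary)
    also have "\<dots> = hemisphere m k (\<phi> True) + hemisphere m k (\<phi> False)"
      using Suc.prems by (intro arg_cong2[where f = "(+)"] hemisphere_cong refl neg[of k]) auto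
    finally show ?case using Suc by (simp add: hemisphere_add)
  qed
  have zero: "\<phi> s \<sigma> = 0" if \<sigma>: "\<sigma> \<in> grid_simplices d m" for s \<sigma>
  proof (rule ccontr)
    assume "\<phi> s \<sigma> \<noteq> 0"
    then have "length (sort (map lab \<sigma>)) \<le> d - 0"
      unfolding \<phi>_def using no'[OF order_refl \<sigma>] less \<sigma>
      by (intro alternating_sorted_bound[of s]) (auto simp: grid_simplices_def subset_iff)
    then show False using \<sigma> by (auto simp: grid_simplices_def)
  qed
  have "hemisphere m d (\<lambda>\<sigma>. \<phi> True \<sigma> + \<phi> False \<sigma>) = hemisphere m d (\<lambda>\<sigma>. 0)"
    by (rule hemisphere_cong) (simp add: zero)
  also have "\<dots> = 0"
    using hemisphere_add[of m d "\<lambda>_. 0" "\<lambda>_. 0"] by (simp add: bit_double)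
  finally show False using one[of d] by simp
qed

section \<open>Paths of bad vertices\<close>

definition bad_edges :: "(nat \<Rightarrow> int) set \<Rightarrow> ((nat \<Rightarrow> int) \<times> (nat \<Rightarrow> int)) set" where
  "bad_edges B = {(v, w). v \<in> B \<and> w \<in> B \<and> adjacent v w}"

lemma sym_bad_edges: "sym (bad_edges B)"
  by (auto simp: sym_def bad_edges_def intro: adjacent_sym)

lemma rtrancl_bad_edges_sym: "(v, w) \<in> (bad_edges B)\<^sup>* \<Longrightarrow> (w, v) \<in> (bad_edges B)\<^sup>*"
  using sym_bad_edges sym_rtrancl symD by metis

lemma rtrancl_bad_edges_antipode:
  assumes "antipode ` B \<subseteq> B" "(v, w) \<in> (bad_edges B)\<^sup>*"
  shows "(antipode v, antipode w) \<in> (bad_edges B)\<^sup>*"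
  using assms(2)
proof induction
  case (step y z)
  then have "(antipode y, antipode z) \<in> bad_edges B"
    using assms(1) by (auto simp: bad_edges_def)
  then show ?case using step.IH by (rule rtrancl_into_rtrancl[rotated])
qed simp

text \<open>Were every component of the bad vertices disjoint from its antipode, one could label the
  bad vertices by $\pm d$, constantly on components, and a good vertex \<open>v\<close> by the smaller of the
  colours of \<open>v\<close> and its antipode. As these two colours differ, good vertices get labels in
  $\pm\{1,\dots,d-1\}$, and Tucker's lemma applies.\<close>
lemma antipodal_bad_component:
  assumes d: "0 < d"
    and B: "antipode ` B \<subseteq> B"
    and less: "\<And>v. v \<in> grid_sphere d m - B \<Longrightarrow> c v < d"
    and neq: "\<And>v w. v \<in> grid_sphere d m - B \<Longrightarrow> w \<in> grid_sphere d m - B \<Longrightarrow> adjacent v w \<Longrightarrow>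
      c v \<noteq> c (antipode w)"
  obtains v where "v \<in> B" "(v, antipode v) \<in> (bad_edges B)\<^sup>*"
proof (rule ccontr)
  assume "\<not> thesis"
  then have none: "(v, antipode v) \<notin> (bad_edges B)\<^sup>*" if "v \<in> B" for v
    using that \<open>\<And>v. v \<in> B \<Longrightarrow> (v, antipode v) \<in> (bad_edges B)\<^sup>* \<Longrightarrow> thesis\<close> by blast
  define C where "C v = {w. (v, w) \<in> (bad_edges B)\<^sup>*}" for v
  \<comment> \<open>The union is symmetric in \<open>v\<close> and its antipode, so both get the
    same representative. The component that contains it receives the positive label.\<close>
  define r where "r v = (SOME w. w \<in> C v \<union> C (antipode v))" for v
  define lab where "lab v = (if v \<in> B then if r v \<in> C v then 2 * (d - 1) else 2 * (d - 1) + 1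
      else if c v < c (antipode v) then 2 * c v else 2 * c (antipode v) + 1)" for v
  have B_iff [simp]: "antipode v \<in> B \<longleftrightarrow> v \<in> B" for v
    using B antipode_antipode by (metis image_subset_iff)
  have refl: "v \<in> C v" for v by (simp add: C_def)
  have r: "r v \<in> C v \<union> C (antipode v)" for v
    unfolding r_def by (rule someI[of _ v]) (simp add: refl)
  have disj: "C v \<inter> C (antipode v) = {}" if "v \<in> B" for v
    using none[OF that] by (auto simp: C_def dest: rtrancl_bad_edges_sym rtrancl_trans)
  have C_eq: "C v = C w" if "(v, w) \<in> (bad_edges B)\<^sup>*" for v w
    using that unfolding C_def by (auto dest: rtrancl_bad_edges_sym intro: rtrancl_trans)
  have r_antipode: "r (antipode v) = r v" for v
    by (simp add: r_def Un_commute)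
  have flip_even: "flip (2 * k) = 2 * k + 1" "flip (2 * k + 1) = 2 * k" "flip (Suc (2 * k)) = 2 * k" for k
    by (simp_all add: flip_def)
  have bad_cases: "r v \<in> C v \<longleftrightarrow> r v \<notin> C (antipode v)" if "v \<in> B" for v
    using r[of v] disj[OF that] by auto
  have neq1: "c v \<noteq> c (antipode v)" if "v \<in> grid_sphere d m - B" for v
    using neq[OF that that] by simp
  have "lab (antipode v) = flip (lab v)" if "v \<in> grid_sphere d m" for v
  proof (cases "v \<in> B")
    case True
    then show ?thesis
      using bad_cases[OF True] by (auto simp: lab_def r_antipode flip_even simp del: mult_Suc_right)
  next
    case False
    then show ?thesis
      using neq1[of v] that flip_even[of "c v"] flip_even[of "c (antipode v)"]
      by (auto simp: lab_def)
  qed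
  moreover have "lab v < 2 * d" if "v \<in> grid_sphere d m" for v
  proof (cases "v \<in> B")
    case False
    then show ?thesis
      using neq1[of v] less[of v] less[of "antipode v"] that by (auto simp: lab_def)
  qed (use d in \<open>auto simp: lab_def\<close>)
  moreover have "lab w \<noteq> flip (lab v)"
    if vw: "v \<in> grid_sphere d m" "w \<in> grid_sphere d m" "adjacent v w" for v w
  proof
    assume eq: "lab w = flip (lab v)"
    then have div: "lab w div 2 = lab v div 2" by (auto simp: flip_def elim!: oddE)
    have small: "lab u div 2 < d - 1" if "u \<in> grid_sphere d m" "u \<notin> B" for u
      using neq1[of u] less[of u] less[of "antipode u"] that by (auto simp: lab_def)
    have large: "lab u div 2 = d - 1" if "u \<in> B" for u
      using that by (auto simp: lab_def)
    \<comment> \<open>Only bad vertices have labels of absolute value d, so a complementary edge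
      joins two bad or two good vertices.\<close>
    consider "v \<in> B" "w \<in> B" | "v \<notin> B" "w \<notin> B"
      using div small[of v] small[of w] large[of v] large[of w] vw by fastforce
    then show False
    proof cases
      case 1
      then have "(v, w) \<in> (bad_edges B)\<^sup>*" using vw by (auto simp: bad_edges_def)
      then have "C v = C w" "C (antipode v) = C (antipode w)"
        using rtrancl_bad_edges_antipode[OF B] C_eq by blast+
      then have "lab v = lab w" using 1 by (simp add: lab_def r_def)
      then show False using eq by (metis even_flip)
    next
      case 2
      have "c v \<noteq> c (antipode w)" "c w \<noteq> c (antipode v)"
        using neq[of v w] neq[of w v] vw 2 adjacent_sym by auto
      then show False
        using 2 eq flip_even by (auto simp: lab_def split: if_splits) (metis Suc_eq_plus1 even_Suc even_mult_iff dvd_refl nat_mult_eq_cancel1 zero_less_numeral)+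
    qed
  qed
  ultimately show False
    using tucker_grid[of d m lab] by metis
qed

section \<open>Long simple paths between antipodes\<close>

lemma rtrancl_distinct_path:
  assumes "(x, y) \<in> r\<^sup>*"
  obtains p where "p \<noteq> []" "hd p = x" "last p = y" "distinct p" "successively (\<lambda>a b. (a, b) \<in> r) p"
proof -
  from assms have "\<exists>p. p \<noteq> [] \<and> hd p = x \<and> last p = y \<and> distinct p \<and> successively (\<lambda>a b. (a, b) \<in> r) p"
  proof induction
    case base
    then show ?case by (intro exI[of _ "[x]"]) auto
  next
    case (step y z)
    then obtain p where p: "p \<noteq> []" "hd p = x" "last p = y" "distinct p"
      "successively (\<lambda>a b. (a, b) \<in> r) p" by blast
    show ?case
    proof (cases "z \<in> set p")
      case True
      then obtain q q' where "p = q @ z # q'" by (auto simp: in_set_conv_decomp)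
      then show ?thesis
        using p by (intro exI[of _ "q @ [z]"]) (auto simp: successively_append_iff hd_append)
    next
      case False
      then show ?thesis
        using p step by (intro exI[of _ "p @ [z]"]) (auto simp: successively_append_iff)
    qed
  qed
  then show ?thesis using that by blast
qed

lemma adjacent_walk_length:
  assumes "successively adjacent p" "p \<noteq> []"
  shows "\<bar>hd p i - last p i\<bar> \<le> int (length p) - 1"
  using assms
proof (induction p rule: induct_list012)
  case (3 x y zs)
  then have "\<bar>y i - last (y # zs) i\<bar> \<le> int (length (y # zs)) - 1" "\<bar>x i - y i\<bar> \<le> 1"
    by (auto simp: adjacent_def)
  then show ?case by auto
qed auto

text \<open>A coordinate of modulus \<open>m\<close> has to change its sign in steps of at most 1,
  so there is room for \<open>m\<close> vertices. Cutting the path to exactly this length prepares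
  the count; distinctness will make its cells disjoint.\<close>

lemma long_bad_path:
  assumes B: "B \<subseteq> grid_sphere d m" and v: "v \<in> B" "(v, antipode v) \<in> (bad_edges B)\<^sup>*"
  obtains p where "length p = m" "distinct p" "set p \<subseteq> B" "successively adjacent p"
proof -
  obtain p where p: "p \<noteq> []" "hd p = v" "last p = antipode v" "distinct p"
    "successively (\<lambda>a b. (a, b) \<in> bad_edges B) p"
    using rtrancl_distinct_path[OF v(2)] by blast
  have adj: "successively adjacent p"
    by (rule successively_mono[OF p(5)]) (auto simp: bad_edges_def)
  have "set p \<subseteq> B"
    using p(1,2,5) v(1)
  proof (induction p arbitrary: v)
    case (Cons a p)
    then show ?case by (cases p) (auto simp: bad_edges_def)
  qed simp
  moreover obtain i where "\<bar>v i\<bar> = int m"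
    using v B by (auto simp: grid_sphere_def)
  then have "m \<le> length p"
    using adjacent_walk_length[OF adj p(1), of i] p(2,3) by (auto simp: antipode_def)
  moreover have "successively adjacent (take m p)"
    using adj successively_append_iff[of adjacent "take m p" "drop m p"] by simp
  ultimately show ?thesis
    using p(4) that[of "take m p"] set_take_subset[of m p] by auto
qed

text \<open>Choosing an empty cell from each antipodal pair along a bad path preserves adjacency only
  up to sign.\<close>
definition near :: "(nat \<Rightarrow> int) \<Rightarrow> (nat \<Rightarrow> int) \<Rightarrow> bool" where
  "near v w \<longleftrightarrow> adjacent v w \<or> adjacent (antipode v) w"

text \<open>Repetitions are allowed, since choosing signs may merge a vertex of a path with its
  antipode.\<close>

definition walks :: "nat \<Rightarrow> nat \<Rightarrow> nat \<Rightarrow> (nat \<Rightarrow> int) list set" where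
  "walks d m l = {p. length p = l \<and> set p \<subseteq> grid_sphere d m \<and> successively near p}"

section \<open>Counting walks\<close>

lemma card_box_le:
  assumes "\<And>i. i \<le> d \<Longrightarrow> finite (S i)" "\<And>i. i \<le> d \<Longrightarrow> card (S i) \<le> k"
    and A: "A \<subseteq> {v. (\<forall>i\<le>d. v i \<in> S i) \<and> (\<forall>i>d. v i = (0::int))}"
  shows "finite A \<and> card A \<le> k ^ (d + 1)"
proof -
  have eq: "{v. (\<forall>i\<le>d. v i \<in> S i) \<and> (\<forall>i>d. v i = (0::int))} = PiE_dflt {..d} 0 S"
    by (simp add: PiE_dflt_def not_le all_conj_distrib)
  have fin: "finite (PiE_dflt {..d} 0 S)"
    using assms(1) by (intro finite_PiE_dflt) auto
  have "card A \<le> card (PiE_dflt {..d} 0 S)"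
    using A fin unfolding eq by (intro card_mono)
  also have "\<dots> = (\<Prod>i\<le>d. card (S i))"
    using assms(1) by (subst card_PiE_dflt) auto
  also have "\<dots> \<le> (\<Prod>i\<le>d. k)"
    using assms(2) by (intro prod_mono) auto
  finally show ?thesis
    using A fin unfolding eq by (auto intro: finite_subset)
qed

lemma card_grid_sphere: "finite (grid_sphere d m) \<and> card (grid_sphere d m) \<le> (2 * m + 1) ^ (d + 1)"
  by (rule card_box_le[where S = "\<lambda>_. {- int m..int m}"])
     (auto simp: grid_sphere_def abs_le_iff minus_le_iff)

lemma card_neighbours:
  "finite {w \<in> grid_sphere d m. adjacent v w} \<and> card {w \<in> grid_sphere d m. adjacent v w} \<le> 3 ^ (d + 1)"
  by (rule card_box_le[where S = "\<lambda>i. {v i - 1..v i + 1}"])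
     (auto simp: grid_sphere_def adjacent_def abs_le_iff algebra_simps)

lemma card_near:
  "finite {w \<in> grid_sphere d m. near v w} \<and> card {w \<in> grid_sphere d m. near v w} \<le> 2 * 3 ^ (d + 1)"
proof -
  have eq: "{w \<in> grid_sphere d m. near v w} =
      {w \<in> grid_sphere d m. adjacent v w} \<union> {w \<in> grid_sphere d m. adjacent (antipode v) w}"
    by (auto simp: near_def)
  show ?thesis
    unfolding eq using card_neighbours[of d m v] card_neighbours[of d m "antipode v"]
    by (auto intro: order_trans[OF card_Un_le])
qed

lemma near_sym: "near v w \<Longrightarrow> near w v"
  unfolding near_def by (metis adjacent_antipode adjacent_sym antipode_antipode)

lemma card_walks:
  "finite (walks d m (Suc l)) \<and>
   card (walks d m (Suc l)) \<le> (2 * m + 1) ^ (d + 1) * (2 * 3 ^ (d + 1)) ^ l"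
proof (induction l)
  case 0
  have "walks d m (Suc 0) = (\<lambda>v. [v]) ` grid_sphere d m"
    by (auto simp: walks_def length_Suc_conv)
  then show ?case
    using card_grid_sphere[of d m] by (auto intro: order_trans[OF card_image_le])
next
  case (Suc l)
  let ?S = "\<lambda>p. (\<lambda>w. w # p) ` {w \<in> grid_sphere d m. near (hd p) w}"
  have sub: "walks d m (Suc (Suc l)) \<subseteq> (\<Union>p\<in>walks d m (Suc l). ?S p)" (is "_ \<subseteq> ?U")
  proof
    fix q assume "q \<in> walks d m (Suc (Suc l))"
    then obtain w v p where "q = w # v # p" "length p = l" "near w v" "v # p \<in> walks d m (Suc l)"
      "w \<in> grid_sphere d m"
      by (auto simp: walks_def length_Suc_conv)
    then show "q \<in> ?U"
      by (intro UN_I[of "v # p"]) (auto intro: near_sym)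
  qed
  have fin: "finite ?U"
    using Suc card_near by (intro finite_UN_I finite_imageI) auto
  have "card ?U \<le> (\<Sum>p\<in>walks d m (Suc l). card (?S p))"
    using Suc by (intro card_UN_le) auto
  also have "\<dots> \<le> (\<Sum>p\<in>walks d m (Suc l). 2 * 3 ^ (d + 1))"
    using card_near by (intro sum_mono order_trans[OF card_image_le]) auto
  also have "\<dots> \<le> (2 * m + 1) ^ (d + 1) * (2 * 3 ^ (d + 1)) ^ l * (2 * 3 ^ (d + 1))"
    using Suc by simp
  finally show ?case
    using sub fin by (auto simp: mult_ac intro: finite_subset order_trans[OF card_mono])
qed

text \<open>Only \<open>v\<close> and its antipode can have the image \<open>v\<close>, so at least
  half of the vertices survive.\<close>

lemma card_sign_choice:
  assumes "finite A" "\<And>v. v \<in> A \<Longrightarrow> s v = v \<or> s v = antipode v"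
  shows "card A \<le> 2 * card (s ` A)"
proof -
  have "A \<subseteq> s ` A \<union> antipode ` s ` A"
    using assms(2) by (metis UnCI antipode_antipode image_eqI subsetI)
  then have "card A \<le> card (s ` A \<union> antipode ` s ` A)"
    using assms(1) by (intro card_mono) auto
  also have "\<dots> \<le> card (s ` A) + card (antipode ` s ` A)"
    by (rule card_Un_le)
  also have "\<dots> \<le> 2 * card (s ` A)"
    using assms(1) card_image_le[of "s ` A" antipode] by simp
  finally show ?thesis .
qed

text \<open>The deterministic core. \<open>E\<close> will be the set of empty cells, and
  \<open>c\<close> the colour of a sample point selected from each occupied cell.\<close>

lemma empty_walk:
  assumes d: "0 < d"
    and less: "\<And>v. v \<in> grid_sphere d m - E \<Longrightarrow> c v < d"
    and neq: "\<And>v w. v \<in> grid_sphere d m - E \<Longrightarrow> w \<in> grid_sphere d m - E \<Longrightarrow>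
      adjacent v (antipode w) \<Longrightarrow> c v \<noteq> c w"
  obtains p where "p \<in> walks d m m" "set p \<subseteq> E" "m \<le> 2 * card (set p)"
proof -
  define B where "B = {v \<in> grid_sphere d m. v \<in> E \<or> antipode v \<in> E}"
  have "c v \<noteq> c (antipode w)"
    if "v \<in> grid_sphere d m - B" "w \<in> grid_sphere d m - B" "adjacent v w" for v w
    using that by (intro neq) (auto simp: B_def)
  then obtain v where "v \<in> B" "(v, antipode v) \<in> (bad_edges B)\<^sup>*"
    by (rule antipodal_bad_component[OF d, of B m c, rotated 2]) (auto simp: B_def intro: less)
  moreover have "B \<subseteq> grid_sphere d m"
    by (auto simp: B_def)
  ultimately obtain p where p: "length p = m" "distinct p" "set p \<subseteq> B" "successively adjacent p"
    using long_bad_path by metis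
  define s where "s v = (if v \<in> E then v else antipode v)" for v
  have "successively near (map s p)"
    unfolding successively_map
    by (rule successively_mono[OF p(4)])
       (auto simp: s_def near_def; metis adjacent_antipode antipode_antipode)
  then have "map s p \<in> walks d m m"
    using p by (auto simp: walks_def s_def B_def)
  moreover have "set (map s p) \<subseteq> E"
    using p by (auto simp: s_def B_def)
  moreover have "m \<le> 2 * card (set (map s p))"
    using card_sign_choice[of "set p" s] p(1,2) by (simp add: s_def distinct_card)
  ultimately show ?thesis using that by blast
qed

section \<open>Cells on the sphere\<close>

lemma infnorm_le_iff: "infnorm x \<le> c \<longleftrightarrow> (\<forall>b\<in>Basis. \<bar>x \<bullet> b\<bar> \<le> c)" for x :: "'a::euclidean_space"
  by (simp add: infnorm_Max)

lemma infnorm_less_iff: "infnorm x < c \<longleftrightarrow> (\<forall>b\<in>Basis. \<bar>x \<bullet> b\<bar> < c)" for x :: "'a::euclidean_space"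
  by (simp add: infnorm_Max)

lemma norm_le_DIM_infnorm: "norm x \<le> sqrt DIM('a) * infnorm x" for x :: "'a::euclidean_space"
  using norm_le_infnorm[of x] by simp

lemma sphere_dist_gt_iff:
  fixes x z :: "'a::real_inner"
  assumes "norm x = 1" "norm z = 1" "0 \<le> \<alpha>" "\<alpha> \<le> pi"
  shows "sphere_dist x z > pi - \<alpha> \<longleftrightarrow> x \<bullet> z < - cos \<alpha>"
proof -
  have "\<bar>x \<bullet> z\<bar> \<le> 1"
    using Cauchy_Schwarz_ineq2[of x z] assms(1,2) by simp
  then have "arccos (cos (pi - \<alpha>)) < arccos (x \<bullet> z) \<longleftrightarrow> x \<bullet> z < cos (pi - \<alpha>)"
    by (intro arccos_less_mono) auto
  moreover have "arccos (cos (pi - \<alpha>)) = pi - \<alpha>"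
    using assms(3,4) by (intro arccos_cos) auto
  ultimately show ?thesis
    using assms(1,2) by (simp add: sphere_dist_def)
qed

text \<open>For unit vectors the inner product is |x + z|^2 / 2 - 1, so being joined means that x is
  close to -z.\<close>

lemma sphere_dist_gt:
  fixes x z :: "'a::real_inner"
  assumes "norm x = 1" "norm z = 1" "(norm (x + z))\<^sup>2 / 2 < 1 - cos \<alpha>" "0 < \<alpha>" "\<alpha> \<le> pi"
  shows "sphere_dist x z > pi - \<alpha>"
  using assms dot_norm[of x z] by (subst sphere_dist_gt_iff) auto

text \<open>Numbering the axes by 0, ..., d lets the integer vectors of the grid act as points of
  the Euclidean space.\<close>

locale indexed_basis =
  fixes d :: nat and e :: "nat \<Rightarrow> 'a::euclidean_space"
  assumes bij: "bij_betw e {..d} Basis"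
begin

lemma DIM_eq: "DIM('a) = d + 1"
  using bij_betw_same_card[OF bij] by simp

lemma Basis_eq: "Basis = e ` {..d}"
  using bij by (simp add: bij_betw_def)

definition grid_point :: "(nat \<Rightarrow> int) \<Rightarrow> 'a" where
  "grid_point v = (\<Sum>i\<le>d. of_int (v i) *\<^sub>R e i)"

lemma inner_grid_point: "i \<le> d \<Longrightarrow> grid_point v \<bullet> e i = of_int (v i)"
proof -
  assume i: "i \<le> d"
  have "e j \<bullet> e i = (if j = i then 1 else 0)" if "j \<le> d" for j
  proof -
    have "e j \<in> Basis" "e i \<in> Basis" "e j = e i \<longleftrightarrow> j = i"
      using bij i that by (auto simp: bij_betw_def inj_on_def)
    then show ?thesis by (simp add: inner_Basis)
  qed
  then have "grid_point v \<bullet> e i = (\<Sum>j\<le>d. if j = i then of_int (v j) else 0)"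
    unfolding grid_point_def inner_sum_left by (intro sum.cong) auto
  then show ?thesis using i by simp
qed

lemma grid_point_antipode: "grid_point (antipode v) = - grid_point v"
  by (simp add: grid_point_def antipode_def sum_negf)

lemma infnorm_grid_point:
  assumes "v \<in> grid_sphere d m" shows "infnorm (grid_point v) = real m"
proof (rule antisym)
  show "infnorm (grid_point v) \<le> real m"
    using assms by (auto simp: infnorm_le_iff Basis_eq inner_grid_point grid_sphere_def)
      (metis of_int_abs of_int_le_iff of_int_of_nat_eq)
  obtain i where i: "i \<le> d" "\<bar>v i\<bar> = int m"
    using assms by (auto simp: grid_sphere_def)
  have "\<bar>grid_point v \<bullet> e i\<bar> = real m"
    using i by (metis inner_grid_point of_int_abs of_int_of_nat_eq)
  then show "real m \<le> infnorm (grid_point v)"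
    using Basis_le_infnorm[of "e i" "grid_point v"] i by (simp add: Basis_eq)
qed

lemma infnorm_grid_point_adjacent:
  assumes "adjacent v w" shows "infnorm (grid_point v - grid_point w) \<le> 1"
  using assms unfolding adjacent_def infnorm_le_iff Basis_eq
  by (auto simp: inner_diff_left inner_grid_point) (metis of_int_1_le_iff of_int_abs of_int_diff of_int_le_1_iff)

lemma infnorm_grid_point_diff:
  assumes "v \<in> grid_sphere d m" "w \<in> grid_sphere d m" "v \<noteq> w"
  shows "1 \<le> infnorm (grid_point v - grid_point w)"
proof -
  obtain i where i: "v i \<noteq> w i" using assms(3) by auto
  then have "i \<le> d"
    using assms(1,2) by (metis (mono_tags, lifting) grid_sphere_def mem_Collect_eq not_le)
  have "1 \<le> \<bar>v i - w i\<bar>" using i by simp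
  then have "1 \<le> \<bar>(grid_point v - grid_point w) \<bullet> e i\<bar>"
    using \<open>i \<le> d\<close> by (simp add: inner_diff_left inner_grid_point flip: of_int_diff of_int_abs)
  also have "\<dots> \<le> infnorm (grid_point v - grid_point w)"
    using \<open>i \<le> d\<close> by (intro Basis_le_infnorm) (simp add: Basis_eq)
  finally show ?thesis .
qed

text \<open>The points whose radial projection to the boundary of the cube $[-m,m]^{d+1}$ is within
  distance $1/2$ of the grid point, in the maximum norm.\<close>
definition cell :: "nat \<Rightarrow> (nat \<Rightarrow> int) \<Rightarrow> 'a set" where
  "cell m v = {x \<in> sphere 0 1.
     infnorm (real m *\<^sub>R x - infnorm x *\<^sub>R grid_point v) < infnorm x / 2}"

lemma uminus_in_cell_iff: "- x \<in> cell m v \<longleftrightarrow> x \<in> cell m (antipode v)"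
proof -
  have "real m *\<^sub>R (- x) - infnorm (- x) *\<^sub>R grid_point v =
      - (real m *\<^sub>R x - infnorm x *\<^sub>R grid_point (antipode v))"
    by (simp add: infnorm_neg grid_point_antipode)
  then have "infnorm (real m *\<^sub>R (- x) - infnorm (- x) *\<^sub>R grid_point v) =
      infnorm (real m *\<^sub>R x - infnorm x *\<^sub>R grid_point (antipode v))"
    by (simp only: infnorm_neg)
  then show ?thesis by (simp add: cell_def infnorm_neg)
qed

text \<open>The projection of a common point would be less than 1/2 away from two grid points at
  distance at least 1; the estimate is scaled by \<open>infnorm x\<close>.\<close>

lemma cell_disjoint:
  assumes "v \<in> grid_sphere d m" "w \<in> grid_sphere d m" "v \<noteq> w"
  shows "cell m v \<inter> cell m w = {}"
proof (rule ccontr)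
  assume "\<not> ?thesis"
  then obtain x where x: "x \<in> cell m v" "x \<in> cell m w" by blast
  let ?a = "real m *\<^sub>R x - infnorm x *\<^sub>R grid_point v"
  let ?b = "real m *\<^sub>R x - infnorm x *\<^sub>R grid_point w"
  have "infnorm x * 1 \<le> infnorm x * infnorm (grid_point v - grid_point w)"
    by (intro mult_left_mono infnorm_grid_point_diff[OF assms] infnorm_pos_le)
  also have "\<dots> = infnorm (?b - ?a)"
    by (simp add: infnorm_mul real_abs_infnorm flip: scaleR_diff_right)
  also have "\<dots> \<le> infnorm ?b + infnorm ?a"
    using infnorm_triangle[of ?b "- ?a"] unfolding infnorm_neg by simp
  also have "\<dots> < infnorm x"
    using x by (simp add: cell_def)
  finally show False by simp
qed

text \<open>The projections \<open>a *\<^sub>R x\<close> and \<open>b *\<^sub>R y\<close> to the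
  cube differ by at most 1/2 + 1 + 1/2 in the maximum norm, hence by 2 sqrt(d + 1) in the Euclidean
  one. Their lengths a and b differ by no more than that, which accounts for the 4; dividing by a,
  which is at least \<open>m\<close>, returns to the sphere.\<close>

lemma cells_close:
  assumes vw: "v \<in> grid_sphere d m" "w \<in> grid_sphere d m" "adjacent v w" and m: "0 < m"
    and x: "x \<in> cell m v" and y: "y \<in> cell m w"
  shows "norm (x - y) \<le> 4 * sqrt (d + 1) / m"
proof -
  have pos: "0 < infnorm x" "0 < infnorm y"
    using x y by (auto simp: cell_def infnorm_pos_lt)
  define a b where "a = m / infnorm x" and "b = m / infnorm y"
  have one: "norm x = 1" "norm y = 1"
    using x y by (auto simp: cell_def)
  have ab: "real m \<le> a" "0 < b"
    using pos m infnorm_le_norm[of x] one by (auto simp: a_def b_def field_simps)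
  have near: "infnorm ((m / infnorm z) *\<^sub>R z - grid_point u) < 1 / 2" if "z \<in> cell m u" for z u
  proof -
    have z: "0 < infnorm z" using that by (auto simp: cell_def infnorm_pos_lt)
    have eq: "(m / infnorm z) *\<^sub>R z - grid_point u =
        (1 / infnorm z) *\<^sub>R (real m *\<^sub>R z - infnorm z *\<^sub>R grid_point u)"
      using z by (simp add: scaleR_diff_right)
    have "infnorm ((m / infnorm z) *\<^sub>R z - grid_point u) =
        infnorm (real m *\<^sub>R z - infnorm z *\<^sub>R grid_point u) / infnorm z"
      unfolding eq infnorm_mul using z by simp
    moreover have "\<dots> < 1 / 2"
      using that z by (simp add: cell_def divide_less_eq)
    ultimately show ?thesis by simp
  qed
  let ?u = "a *\<^sub>R x - grid_point v" and ?w = "b *\<^sub>R y - grid_point w"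
  have "infnorm (a *\<^sub>R x - b *\<^sub>R y) = infnorm (?u + (grid_point v - grid_point w) + - ?w)"
    by (simp add: algebra_simps)
  also have "\<dots> \<le> infnorm ?u + infnorm (grid_point v - grid_point w) + infnorm ?w"
    using infnorm_triangle[of "?u + (grid_point v - grid_point w)" "- ?w"]
      infnorm_triangle[of ?u "grid_point v - grid_point w"]
    unfolding infnorm_neg by linarith
  also have "\<dots> \<le> 1 / 2 + 1 + 1 / 2"
    using near[OF x] near[OF y] infnorm_grid_point_adjacent[OF vw(3)]
    by (simp add: a_def b_def)
  finally have inf: "infnorm (a *\<^sub>R x - b *\<^sub>R y) \<le> 2" by simp
  have "norm (a *\<^sub>R x - b *\<^sub>R y) \<le> sqrt (d + 1) * infnorm (a *\<^sub>R x - b *\<^sub>R y)"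
    using norm_le_DIM_infnorm[of "a *\<^sub>R x - b *\<^sub>R y"] by (simp add: DIM_eq)
  also have "\<dots> \<le> sqrt (d + 1) * 2"
    using inf by (intro mult_left_mono) auto
  finally have N: "norm (a *\<^sub>R x - b *\<^sub>R y) \<le> 2 * sqrt (d + 1)" by simp
  have "\<bar>b - a\<bar> = \<bar>norm (a *\<^sub>R x) - norm (b *\<^sub>R y)\<bar>"
    using ab m one by simp
  also have "\<dots> \<le> norm (a *\<^sub>R x - b *\<^sub>R y)"
    by (rule norm_triangle_ineq3)
  finally have ba: "\<bar>b - a\<bar> \<le> 2 * sqrt (d + 1)" using N by simp
  have "a * norm (x - y) = norm (a *\<^sub>R (x - y))"
    using ab m by simp
  also have "a *\<^sub>R (x - y) = (a *\<^sub>R x - b *\<^sub>R y) + (b - a) *\<^sub>R y"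
    by (simp add: algebra_simps)
  also have "norm \<dots> \<le> 2 * sqrt (d + 1) + \<bar>b - a\<bar>"
    using N one by (intro order_trans[OF norm_triangle_ineq]) simp
  finally have "a * norm (x - y) \<le> 4 * sqrt (d + 1)"
    using ba by simp
  moreover have "m * norm (x - y) \<le> a * norm (x - y)"
    using ab by (intro mult_right_mono) auto
  ultimately show ?thesis
    using m by (simp add: field_simps)
qed

text \<open>An occupied cell takes the colour of a sample point in it. If one cell is adjacent to
  the antipode of another, their points are nearly antipodal, hence joined and coloured
  differently.\<close>

lemma colouring_imp_empty_walk:
  assumes m: "0 < m" and d: "0 < d"
    and X: "\<And>i. i \<in> {1..n} \<Longrightarrow> X i \<in> sphere 0 1"
    and \<alpha>: "0 < \<alpha>" "\<alpha> < pi" "8 * (d + 1) / (real m)\<^sup>2 < 1 - cos \<alpha>"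
    and f: "proper_colouring {1..n} (borsuk_edges n \<alpha> X) d f"
  obtains p where "p \<in> walks d m m" "m \<le> 2 * card (set p)"
    "\<And>i. i \<in> {1..n} \<Longrightarrow> X i \<notin> (\<Union>v\<in>set p. cell m v)"
proof -
  define E where "E = {v. \<forall>i\<in>{1..n}. X i \<notin> cell m v}"
  define x where "x v = (SOME i. i \<in> {1..n} \<and> X i \<in> cell m v)" for v
  have x: "x v \<in> {1..n}" "X (x v) \<in> cell m v" if "v \<notin> E" for v
  proof -
    have "\<exists>i. i \<in> {1..n} \<and> X i \<in> cell m v"
      using that by (auto simp: E_def)
    then have "x v \<in> {1..n} \<and> X (x v) \<in> cell m v"
      unfolding x_def by (rule someI_ex)
    then show "x v \<in> {1..n}" "X (x v) \<in> cell m v" by blast+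
  qed
  have "f (x v) < d" if "v \<in> grid_sphere d m - E" for v
    using f x[of v] that by (auto simp: proper_colouring_def image_subset_iff)
  moreover have "f (x v) \<noteq> f (x w)"
    if v: "v \<in> grid_sphere d m - E" and w: "w \<in> grid_sphere d m - E" and adj: "adjacent v (antipode w)"
    for v w
  proof -
    have xv: "x v \<in> {1..n}" "X (x v) \<in> cell m v" and xw: "x w \<in> {1..n}" "- X (x w) \<in> cell m (antipode w)"
      using x[of v] x[of w] v w by (auto simp: uminus_in_cell_iff)
    have "norm (X (x v) + X (x w)) \<le> 4 * sqrt (d + 1) / m"
      using cells_close[OF _ _ adj m xv(2) xw(2)] v w by simp
    then have "(norm (X (x v) + X (x w)))\<^sup>2 \<le> (4 * sqrt (d + 1) / m)\<^sup>2"
      by (intro power_mono) auto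
    \<comment> \<open>Half the squared bound of \<open>cells_close\<close>, which is where the
      hypothesis on \<alpha> comes from.\<close>
    moreover have "(4 * sqrt (d + 1) / m)\<^sup>2 / 2 = 8 * (d + 1) / (real m)\<^sup>2"
      using m by (simp add: power_divide power_mult_distrib field_simps)
    ultimately have "(norm (X (x v) + X (x w)))\<^sup>2 / 2 < 1 - cos \<alpha>"
      using \<alpha>(3) by linarith
    then have gt: "sphere_dist (X (x v)) (X (x w)) > pi - \<alpha>"
      using X[OF xv(1)] X[OF xw(1)] \<alpha> by (intro sphere_dist_gt) auto
    \<comment> \<open>One point cannot represent both cells: its distance 0 from itself is below pi
      - \<alpha>.\<close>
    moreover have "x v \<noteq> x w"
    proof
      assume "x v = x w"
      then have "sphere_dist (X (x v)) (X (x w)) = 0"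
        using X[OF xv(1)] by (simp add: sphere_dist_def flip: power2_norm_eq_inner)
      then show False using gt \<alpha> by simp
    qed
    ultimately have "{x v, x w} \<in> borsuk_edges n \<alpha> X"
      using xv xw unfolding borsuk_edges_def by blast
    then show ?thesis
      using f xv xw unfolding proper_colouring_def by blast
  qed
  ultimately obtain p where "p \<in> walks d m m" "set p \<subseteq> E" "m \<le> 2 * card (set p)"
    using empty_walk[OF d, of m E "\<lambda>v. f (x v)"] by metis
  then show ?thesis
    by (intro that[of p]) (auto simp: E_def)
qed

section \<open>The measure of a cell\<close>

lemma open_cone: "open {y. infnorm (real m *\<^sub>R y - infnorm y *\<^sub>R grid_point v) < infnorm y / 2}"
  by (intro open_Collect_less continuous_intros) simp_all

lemma cell_borel: "cell m v \<in> sets borel"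
proof -
  have "cell m v = sphere 0 1 \<inter> {y. infnorm (real m *\<^sub>R y - infnorm y *\<^sub>R grid_point v) < infnorm y / 2}"
    by (auto simp: cell_def)
  then show ?thesis using open_cone by auto
qed

text \<open>The inequality defining a cell is homogeneous, so it cuts the cone out of the ball as
  well.\<close>

lemma cone_cell:
  "{r *\<^sub>R u | r u. 0 < r \<and> r < 1 \<and> u \<in> cell m v} =
     ball 0 1 \<inter> {y. infnorm (real m *\<^sub>R y - infnorm y *\<^sub>R grid_point v) < infnorm y / 2}"
    (is "?L = ?R")
proof -
  have hom: "infnorm (real m *\<^sub>R (r *\<^sub>R u) - infnorm (r *\<^sub>R u) *\<^sub>R grid_point v) < infnorm (r *\<^sub>R u) / 2
      \<longleftrightarrow> infnorm (real m *\<^sub>R u - infnorm u *\<^sub>R grid_point v) < infnorm u / 2"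
    if "0 < r" for r u
  proof -
    have "real m *\<^sub>R (r *\<^sub>R u) - infnorm (r *\<^sub>R u) *\<^sub>R grid_point v =
        r *\<^sub>R (real m *\<^sub>R u - infnorm u *\<^sub>R grid_point v)"
      using that by (simp add: infnorm_mul scaleR_diff_right mult.commute)
    then have "infnorm (real m *\<^sub>R (r *\<^sub>R u) - infnorm (r *\<^sub>R u) *\<^sub>R grid_point v) =
        r * infnorm (real m *\<^sub>R u - infnorm u *\<^sub>R grid_point v)"
      using that by (simp only: infnorm_mul abs_of_pos)
    moreover have "infnorm (r *\<^sub>R u) / 2 = r * (infnorm u / 2)"
      using that by (simp add: infnorm_mul)
    ultimately show ?thesis
      using that by (simp only: mult_less_cancel_left_pos)
  qed
  show ?thesis
  proof
    show "?L \<subseteq> ?R"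
    proof
      fix y assume "y \<in> ?L"
      then obtain r u where y: "y = r *\<^sub>R u" "0 < r" "r < 1" "u \<in> cell m v" by blast
      then show "y \<in> ?R"
        using hom[of r u] unfolding y(1) by (simp add: cell_def del: scaleR_scaleR)
    qed
    show "?R \<subseteq> ?L"
    proof
      fix y assume y: "y \<in> ?R"
      then have "y \<noteq> 0" by (auto simp: infnorm_0)
      then have "y = norm y *\<^sub>R (y /\<^sub>R norm y)" "0 < norm y" "norm (y /\<^sub>R norm y) = 1"
        by auto
      moreover from this have "y /\<^sub>R norm y \<in> cell m v"
        using y hom[of "norm y" "y /\<^sub>R norm y"] by (auto simp: cell_def)
      ultimately show "y \<in> ?L"
        using y by (intro CollectI exI[of _ "norm y"] exI[of _ "y /\<^sub>R norm y"]) auto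
    qed
  qed
qed

text \<open>The cone over a cell contains \<open>m\<close> disjoint cubes of side length of order $1/m$, stacked
  along the ray through the grid point.\<close>
lemma measure_cell_ge:
  assumes v: "v \<in> grid_sphere d m" and m: "0 < m"
  shows "1 / ((6 * (d + 1)) ^ (d + 1) * measure lborel (ball 0 1 :: 'a set)) / real m ^ d \<le>
    measure uniform_sphere (cell m v)"
proof -
  \<comment> \<open>Maximum norm below 3 s m then forces Euclidean norm below 1. The centres
    \<open>q k\<close> have maximum norms s apart, while the cubes have half side s / 4.\<close>
  define s where "s = 1 / (3 * real m * (d + 1))"
  define q where "q k = (s * (real m + real k) / m) *\<^sub>R grid_point v" for k :: nat
  define Q where "Q k = box (q k - (s / 4) *\<^sub>R One) (q k + (s / 4) *\<^sub>R One)" for k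
  let ?V = "measure lborel (ball 0 1 :: 'a set)"
  have s: "0 < s" using m by (simp add: s_def)
  have Q: "y \<in> Q k \<longleftrightarrow> infnorm (y - q k) < s / 4" for y k
    unfolding Q_def mem_box infnorm_less_iff
  proof (intro ball_cong refl)
    fix b :: 'a assume "b \<in> Basis"
    then have "One \<bullet> b = 1" by simp
    then show "((q k - (s / 4) *\<^sub>R One) \<bullet> b < y \<bullet> b \<and> y \<bullet> b < (q k + (s / 4) *\<^sub>R One) \<bullet> b) \<longleftrightarrow>
        \<bar>(y - q k) \<bullet> b\<bar> < s / 4"
      unfolding inner_diff_left inner_add_left inner_scaleR_left by (simp only: mult_1_right) linarith
  qed
  have infq: "infnorm (q k) = s * (real m + real k)" for k
    using s m by (simp add: q_def infnorm_mul infnorm_grid_point[OF v])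
  have "Q k \<subseteq> ball 0 1 \<inter> {y. infnorm (real m *\<^sub>R y - infnorm y *\<^sub>R grid_point v) < infnorm y / 2}"
    if k: "k \<in> {1..m}" for k
  proof
    fix y assume "y \<in> Q k"
    then have z: "infnorm (y - q k) < s / 4" by (simp add: Q)
    have "\<bar>infnorm y - s * (real m + real k)\<bar> < s / 4"
      using absdiff_infnorm[of y "q k"] z infq[of k] by simp
    then have diff: "\<bar>infnorm y - s * (real m + real k)\<bar> < s / 4"
        "\<bar>s * (real m + real k) - infnorm y\<bar> < s / 4"
      by linarith+
    have sk: "s * 1 \<le> s * real k" "s * real k \<le> s * real m" "s * 1 \<le> s * real m"
      using k m s by (intro mult_left_mono; simp)+
    have lower: "s * real m < infnorm y" and upper: "infnorm y < s * (3 * real m)"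
      using diff sk s unfolding distrib_left mult.left_commute[of s 3] by linarith+
    have "norm y \<le> sqrt (d + 1) * infnorm y"
      using norm_le_DIM_infnorm[of y] by (simp add: DIM_eq)
    also have "\<dots> \<le> (d + 1) * infnorm y"
      by (intro mult_right_mono infnorm_pos_le real_le_lsqrt) (auto simp: power2_eq_square)
    also have "\<dots> < (d + 1) * (s * (3 * real m))"
      using upper by (intro mult_strict_left_mono) auto
    also have "\<dots> = 1" using m by (simp add: s_def)
    finally have "norm y < 1" .
    moreover have "infnorm (real m *\<^sub>R y - infnorm y *\<^sub>R grid_point v) < infnorm y / 2"
    proof -
      have "real m *\<^sub>R q k = (s * (real m + real k)) *\<^sub>R grid_point v"
        using m by (simp add: q_def)
      then have "real m *\<^sub>R y - infnorm y *\<^sub>R grid_point v =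
          real m *\<^sub>R (y - q k) + (s * (real m + real k) - infnorm y) *\<^sub>R grid_point v"
        by (simp add: algebra_simps)
      then have "infnorm (real m *\<^sub>R y - infnorm y *\<^sub>R grid_point v) \<le>
          real m * infnorm (y - q k) + \<bar>s * (real m + real k) - infnorm y\<bar> * real m"
        using infnorm_triangle[of "real m *\<^sub>R (y - q k)" "(s * (real m + real k) - infnorm y) *\<^sub>R grid_point v"]
        by (simp add: infnorm_mul infnorm_grid_point[OF v])
      also have "\<dots> \<le> real m * (s / 4) + s / 4 * real m"
        using z diff by (intro add_mono mult_left_mono mult_right_mono) auto
      also have "\<dots> < infnorm y / 2"
        using lower by (simp add: mult.commute)
      finally show ?thesis .
    qed
    ultimately show "y \<in> ball 0 1 \<inter> {y. infnorm (real m *\<^sub>R y - infnorm y *\<^sub>R grid_point v) < infnorm y / 2}"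
      by simp
  qed
  then have sub: "(\<Union>k\<in>{1..m}. Q k) \<subseteq> {r *\<^sub>R u | r u. 0 < r \<and> r < 1 \<and> u \<in> cell m v}"
    unfolding cone_cell by blast
  have disj: "disjoint_family_on Q {1..m}"
    unfolding disjoint_family_on_def
  proof (intro ballI impI, rule ccontr)
    fix j k assume jk: "j \<noteq> k" and "Q j \<inter> Q k \<noteq> {}"
    then obtain y where y: "infnorm (y - q j) < s / 4" "infnorm (y - q k) < s / 4"
      by (auto simp: Q)
    have "\<bar>infnorm y - s * (real m + real j)\<bar> < s / 4" "\<bar>infnorm y - s * (real m + real k)\<bar> < s / 4"
      using absdiff_infnorm[of y "q j"] absdiff_infnorm[of y "q k"] y infq by auto
    then have "\<bar>s * real j - s * real k\<bar> < s / 2"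
      unfolding distrib_left by linarith
    then have "s * \<bar>real j - real k\<bar> < s / 2"
      using s by (simp add: abs_mult flip: right_diff_distrib)
    then have "\<bar>real j - real k\<bar> < 1"
      using s by (simp add: field_simps)
    then show False using jk by linarith
  qed
  have emQ: "emeasure lborel (Q k) = ennreal ((s / 2) ^ (d + 1))" for k
    unfolding Q_def using s
    by (subst emeasure_lborel_box) (auto simp: inner_diff_left inner_add_left DIM_eq)
  \<comment> \<open>One cube has volume of order m^(-d-1); summing over \<open>m\<close> of them
    gives the required m^(-d).\<close>
  have "ennreal (m * (s / 2) ^ (d + 1)) = (\<Sum>k\<in>{1..m}. emeasure lborel (Q k))"
    using s unfolding emQ by (subst ennreal_mult) (auto simp: ennreal_of_nat_eq_real_of_nat simp del: power_Suc)
  also have "\<dots> = emeasure lborel (\<Union>k\<in>{1..m}. Q k)"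
  proof (rule sum_emeasure[OF _ disj])
    show "Q ` {1..m} \<subseteq> sets lborel" by (auto simp: Q_def)
  qed simp
  also have "\<dots> \<le> emeasure lborel {r *\<^sub>R u | r u. 0 < r \<and> r < 1 \<and> u \<in> cell m v}"
    using sub by (rule emeasure_mono) (use open_cone in \<open>auto simp: cone_cell\<close>)
  finally have cone: "ennreal (m * (s / 2) ^ (d + 1)) \<le>
      emeasure lborel {r *\<^sub>R u | r u. 0 < r \<and> r < 1 \<and> u \<in> cell m v}" .
  have Vpos: "0 < ?V" by (rule content_ball_pos) simp
  have V: "emeasure lborel (ball 0 1 :: 'a set) = ennreal ?V"
    using emeasure_lborel_ball_finite[of "0::'a" 1] by (intro emeasure_eq_ennreal_measure) auto
  interpret prob_space "uniform_sphere :: 'a measure" by (rule prob_space_uniform_sphere)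
  have "ennreal (m * (s / 2) ^ (d + 1) / ?V) = ennreal (m * (s / 2) ^ (d + 1)) / ennreal ?V"
    using Vpos s by (intro divide_ennreal[symmetric]) auto
  also have "\<dots> \<le> emeasure lborel {r *\<^sub>R u | r u. 0 < r \<and> r < 1 \<and> u \<in> cell m v} / ennreal ?V"
    by (intro divide_right_mono_ennreal cone)
  also have "\<dots> = emeasure uniform_sphere (cell m v)"
    using cell_borel by (subst uniform_sphere_cone) (auto simp: V cell_def)
  finally have "m * (s / 2) ^ (d + 1) / ?V \<le> measure uniform_sphere (cell m v)"
    by (simp add: emeasure_eq_measure)
  moreover have "m * (s / 2) ^ (d + 1) / ?V = 1 / ((6 * (d + 1)) ^ (d + 1) * ?V) / real m ^ d"
  proof -
    have "s / 2 = 1 / (real m * (6 * (real d + 1)))"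
      by (simp add: s_def)
    then have "(s / 2) ^ (d + 1) = 1 / (real m ^ (d + 1) * (6 * (real d + 1)) ^ (d + 1))"
      by (simp only: power_divide power_mult_distrib power_one)
    then have "m * (s / 2) ^ (d + 1) = 1 / (real m ^ d * (6 * (real d + 1)) ^ (d + 1))"
      using m by simp
    then show ?thesis by (simp add: mult_ac add_ac)
  qed
  ultimately show ?thesis by simp
qed

end

section \<open>Probability estimates\<close>

text \<open>The injective colouring shows that the \<open>LEAST\<close> is attained, and a colouring
  with fewer than \<open>d\<close> colours is also one with \<open>d\<close> colours.\<close>

lemma chromatic_number_gt:
  assumes "finite V" "\<And>v. v \<in> V \<Longrightarrow> {v} \<notin> E" "\<And>f. \<not> proper_colouring V E d f"
  shows "d < chromatic_number V E"
proof (rule ccontr)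
  assume le: "\<not> d < chromatic_number V E"
  obtain g where g: "bij_betw g V {..<card V}"
    using ex_bij_betw_finite_nat[OF assms(1)] by (auto simp: atLeast0LessThan)
  have "proper_colouring V E (card V) g"
    using g assms(2) by (auto simp: proper_colouring_def bij_betw_def inj_on_def)
  then have "\<exists>f. proper_colouring V E (chromatic_number V E) f"
    unfolding chromatic_number_def
    using LeastI_ex[of "\<lambda>k. \<exists>f. proper_colouring V E k f"] by blast
  then obtain f where "proper_colouring V E (chromatic_number V E) f" by blast
  then have "proper_colouring V E d f"
    using le by (auto simp: proper_colouring_def image_subset_iff)
  then show False using assms(3) by blast
qed

lemma singleton_notin_borsuk_edges: "{v} \<notin> borsuk_edges n \<alpha> X"
  by (auto simp: borsuk_edges_def doubleton_eq_iff)

lemma space_iid_sphere: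
  "space (iid_sphere n :: (nat \<Rightarrow> 'a::euclidean_space) measure) = ({1..n} \<rightarrow>\<^sub>E sphere 0 1)"
  by (simp add: iid_sphere_def space_PiM space_uniform_sphere)

lemma prob_space_iid_sphere: "prob_space (iid_sphere n :: (nat \<Rightarrow> 'a::euclidean_space) measure)"
  unfolding iid_sphere_def by (intro prob_space_PiM prob_space_uniform_sphere)

lemma measurable_iid_sphere_component:
  assumes "i \<in> {1..n}"
  shows "(\<lambda>X. X i) \<in> borel_measurable (iid_sphere n :: (nat \<Rightarrow> 'a::euclidean_space) measure)"
proof -
  have "(\<lambda>x. x) \<in> borel_measurable (uniform_sphere :: 'a measure)"
    by (subst measurable_cong_sets[OF sets_uniform_sphere refl])
       (intro measurable_restrict_space1 measurable_ident_sets refl)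
  moreover have "(\<lambda>X. X i) \<in> measurable (iid_sphere n) (uniform_sphere :: 'a measure)"
    unfolding iid_sphere_def using assms by (rule measurable_component_singleton)
  ultimately show ?thesis
    by (rule measurable_compose[rotated])
qed

text \<open>The event depends on the edge set alone, which has finitely many values, each described
  by finitely many conditions on inner products.\<close>

lemma sets_chromatic_number_gt:
  assumes "0 \<le> \<alpha>" "\<alpha> \<le> pi"
  shows "{X \<in> space (iid_sphere n :: (nat \<Rightarrow> 'a::euclidean_space) measure).
    d < chromatic_number {1..n} (borsuk_edges n \<alpha> X)} \<in> sets (iid_sphere n)"
proof -
  let ?M = "iid_sphere n :: (nat \<Rightarrow> 'a) measure"
  let ?P = "{{i, j} | i j. i \<in> {1..n} \<and> j \<in> {1..n} \<and> i \<noteq> j}"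
  have "?P \<subseteq> Pow {1..n}" by auto
  then have fin: "finite (Pow ?P)"
    by (meson finite_Pow_iff finite_atLeastAtMost finite_subset)
  have sub: "borsuk_edges n \<alpha> X \<in> Pow ?P" for X :: "nat \<Rightarrow> 'a"
    by (auto simp: borsuk_edges_def)
  have eq: "borsuk_edges n \<alpha> X = E \<longleftrightarrow> (\<forall>i\<in>{1..n}. \<forall>j\<in>{1..n}. i \<noteq> j \<longrightarrow>
      (X i \<bullet> X j < - cos \<alpha>) = ({i, j} \<in> E))" if E: "E \<in> Pow ?P" and X: "X \<in> space ?M" for X E
  proof -
    have dist: "sphere_dist (X i) (X j) > pi - \<alpha> \<longleftrightarrow> X i \<bullet> X j < - cos \<alpha>"
      if "i \<in> {1..n}" "j \<in> {1..n}" for i j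
      using that X assms by (intro sphere_dist_gt_iff) (auto simp: space_iid_sphere PiE_iff)
    have mem: "{i, j} \<in> borsuk_edges n \<alpha> X \<longleftrightarrow> X i \<bullet> X j < - cos \<alpha>"
      if ij: "i \<in> {1..n}" "j \<in> {1..n}" "i \<noteq> j" for i j
    proof
      assume "{i, j} \<in> borsuk_edges n \<alpha> X"
      then show "X i \<bullet> X j < - cos \<alpha>"
        using dist by (auto simp: borsuk_edges_def doubleton_eq_iff inner_commute)
    next
      assume "X i \<bullet> X j < - cos \<alpha>"
      then show "{i, j} \<in> borsuk_edges n \<alpha> X"
        using dist[OF ij(1,2)] ij unfolding borsuk_edges_def by blast
    qed
    show ?thesis
    proof
      assume R: "\<forall>i\<in>{1..n}. \<forall>j\<in>{1..n}. i \<noteq> j \<longrightarrow> (X i \<bullet> X j < - cos \<alpha>) = ({i, j} \<in> E)"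
      have "e \<in> borsuk_edges n \<alpha> X \<longleftrightarrow> e \<in> E" if "e \<in> ?P" for e
      proof -
        from that obtain i j where "e = {i, j}" "i \<in> {1..n}" "j \<in> {1..n}" "i \<noteq> j" by blast
        then show ?thesis using R mem[of i j] by metis
      qed
      then show "borsuk_edges n \<alpha> X = E"
        using E sub[of X] by blast
    next
      assume "borsuk_edges n \<alpha> X = E"
      then show "\<forall>i\<in>{1..n}. \<forall>j\<in>{1..n}. i \<noteq> j \<longrightarrow> (X i \<bullet> X j < - cos \<alpha>) = ({i, j} \<in> E)"
        using mem by metis
    qed
  qed
  have "{X \<in> space ?M. d < chromatic_number {1..n} (borsuk_edges n \<alpha> X)} =
    (\<Union>E\<in>{E \<in> Pow ?P. d < chromatic_number {1..n} E}.
       {X \<in> space ?M. \<forall>i\<in>{1..n}. \<forall>j\<in>{1..n}. i \<noteq> j \<longrightarrow> (X i \<bullet> X j < - cos \<alpha>) = ({i, j} \<in> E)})"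
    (is "?L = ?R")
  proof
    show "?L \<subseteq> ?R"
    proof
      fix X assume X: "X \<in> ?L"
      then show "X \<in> ?R"
        using eq[OF sub[of X], of X] sub[of X]
        by (intro UN_I[of "borsuk_edges n \<alpha> X"]) simp_all
    qed
    show "?R \<subseteq> ?L"
    proof
      fix X assume "X \<in> ?R"
      then obtain E where "E \<in> Pow ?P" "d < chromatic_number {1..n} E" "X \<in> space ?M"
        "\<forall>i\<in>{1..n}. \<forall>j\<in>{1..n}. i \<noteq> j \<longrightarrow> (X i \<bullet> X j < - cos \<alpha>) = ({i, j} \<in> E)"
        by blast
      then show "X \<in> ?L"
        using eq[of E X] by simp
    qed
  qed
  moreover have "{X \<in> space ?M. \<forall>i\<in>{1..n}. \<forall>j\<in>{1..n}. i \<noteq> j \<longrightarrow>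
      (X i \<bullet> X j < - cos \<alpha>) = ({i, j} \<in> E)} \<in> sets ?M" for E
  proof (intro sets.sets_Collect_finite_All finite_atLeastAtMost)
    fix i j assume "i \<in> {1..n}" "j \<in> {1..n}"
    note [measurable] = this[THEN measurable_iid_sphere_component]
    show "{X \<in> space ?M. i \<noteq> j \<longrightarrow> (X i \<bullet> X j < - cos \<alpha>) = ({i, j} \<in> E)} \<in> sets ?M"
      by measurable
  qed
  moreover have "finite {E \<in> Pow ?P. d < chromatic_number {1..n} E}"
    by (rule finite_subset[OF _ fin]) blast
  ultimately show ?thesis
    by (simp only: sets.finite_UN)
qed

lemma prob_avoid:
  assumes "A \<in> sets (uniform_sphere :: 'a::euclidean_space measure)"
  shows "{X \<in> space (iid_sphere n :: (nat \<Rightarrow> 'a) measure). \<forall>i\<in>{1..n}. X i \<notin> A} \<in> sets (iid_sphere n)"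
    and "\<P>(X in (iid_sphere n :: (nat \<Rightarrow> 'a) measure). \<forall>i\<in>{1..n}. X i \<notin> A) =
      (1 - measure uniform_sphere A) ^ n"
proof -
  interpret S: prob_space "uniform_sphere :: 'a measure" by (rule prob_space_uniform_sphere)
  interpret P: finite_product_prob_space "\<lambda>_. uniform_sphere :: 'a measure" "{1..n}"
    by unfold_locales auto
  have eq: "{X \<in> space (iid_sphere n :: (nat \<Rightarrow> 'a) measure). \<forall>i\<in>{1..n}. X i \<notin> A} =
      ({1..n} \<rightarrow>\<^sub>E space uniform_sphere - A)"
    by (auto simp: space_iid_sphere space_uniform_sphere PiE_iff extensional_def)
  show "{X \<in> space (iid_sphere n :: (nat \<Rightarrow> 'a) measure). \<forall>i\<in>{1..n}. X i \<notin> A} \<in> sets (iid_sphere n)"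
    unfolding eq unfolding iid_sphere_def using assms by (intro sets_PiM_I_finite) auto
  show "\<P>(X in (iid_sphere n :: (nat \<Rightarrow> 'a) measure). \<forall>i\<in>{1..n}. X i \<notin> A) =
      (1 - measure uniform_sphere A) ^ n"
    unfolding eq unfolding iid_sphere_def using assms
    by (subst P.prob_times) (auto simp: S.prob_compl)
qed

section \<open>The union bound over walks\<close>

context indexed_basis
begin

lemma cell_sets: "cell m v \<in> sets uniform_sphere"
  unfolding sets_uniform_sphere using cell_borel[of m v]
  by (subst sets_restrict_space_iff) (auto simp: cell_def)

definition cell_const :: real where
  "cell_const = 1 / ((6 * (d + 1)) ^ (d + 1) * measure lborel (ball 0 1 :: 'a set))"

lemma cell_const_pos: "0 < cell_const"
  using content_ball_pos[of 1 "0::'a"] by (simp add: cell_const_def add_nonneg_pos)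

lemma measure_cells_ge:
  assumes "finite V" "V \<subseteq> grid_sphere d m" "0 < m"
  shows "card V * cell_const / real m ^ d \<le> measure uniform_sphere (\<Union>v\<in>V. cell m v)"
proof -
  interpret prob_space "uniform_sphere :: 'a measure" by (rule prob_space_uniform_sphere)
  have "card V * cell_const / real m ^ d = (\<Sum>v\<in>V. cell_const / real m ^ d)"
    by simp
  also have "\<dots> \<le> (\<Sum>v\<in>V. measure uniform_sphere (cell m v))"
    unfolding cell_const_def using assms measure_cell_ge by (intro sum_mono) blast
  also have "\<dots> = measure uniform_sphere (\<Union>v\<in>V. cell m v)"
  proof (rule finite_measure_finite_Union[symmetric])
    show "disjoint_family_on (cell m) V"
      unfolding disjoint_family_on_def using assms(2) cell_disjoint by blast
  qed (use assms cell_sets in auto)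
  finally show ?thesis .
qed

text \<open>At least m / 2 disjoint cells lie on each walk, with total measure \<mu> at least
  \<open>cell_const / 2 * m / m ^ d\<close>, and (1 - \<mu>)^n is at most exp(-n \<mu>). Written as
  an m-th power, this combines with the number of walks into a single base.\<close>

lemma prob_colourable_le:
  assumes m: "0 < m" and d: "0 < d"
    and \<alpha>: "0 < \<alpha>" "\<alpha> < pi" "8 * (d + 1) / (real m)\<^sup>2 < 1 - cos \<alpha>"
  shows "1 - (2 * real m + 1) ^ (d + 1) * (2 * 3 ^ (d + 1) * exp (- cell_const / 2 * (n / real m ^ d))) ^ m \<le>
    \<P>(X in (iid_sphere n :: (nat \<Rightarrow> 'a) measure).
      d < chromatic_number {1..n} (borsuk_edges n \<alpha> X))"
proof -
  let ?M = "iid_sphere n :: (nat \<Rightarrow> 'a) measure"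
  interpret S: prob_space "uniform_sphere :: 'a measure" by (rule prob_space_uniform_sphere)
  interpret prob_space ?M by (rule prob_space_iid_sphere)
  define W where "W = {p \<in> walks d m m. m \<le> 2 * card (set p)}"
  define A where "A p = (\<Union>v\<in>set p. cell m v)" for p
  define F where "F p = {X \<in> space ?M. \<forall>i\<in>{1..n}. X i \<notin> A p}" for p
  define G where "G = {X \<in> space ?M. d < chromatic_number {1..n} (borsuk_edges n \<alpha> X)}"
  obtain l where l: "m = Suc l" using m by (cases m) auto
  have cardW: "finite W" "card W \<le> (2 * m + 1) ^ (d + 1) * (2 * 3 ^ (d + 1)) ^ m"
  proof -
    have fin: "finite (walks d m m)" "card (walks d m m) \<le> (2 * m + 1) ^ (d + 1) * (2 * 3 ^ (d + 1)) ^ l"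
      using card_walks[of d m l] by (simp_all add: l)
    then show "finite W" by (simp add: W_def)
    have "card W \<le> card (walks d m m)"
      using fin by (intro card_mono) (auto simp: W_def)
    also note fin(2)
    also have "(2 * m + 1) ^ (d + 1) * (2 * 3 ^ (d + 1)) ^ l \<le> (2 * m + 1) ^ (d + 1) * (2 * 3 ^ (d + 1) :: nat) ^ m"
      by (intro mult_left_mono power_increasing) (auto simp: l)
    finally show "card W \<le> (2 * m + 1) ^ (d + 1) * (2 * 3 ^ (d + 1)) ^ m" .
  qed
  have A: "A p \<in> sets uniform_sphere" for p
    unfolding A_def using cell_sets by auto
  have F: "F p \<in> events" "prob (F p) = (1 - measure uniform_sphere (A p)) ^ n" for p
    unfolding F_def using prob_avoid[OF A] by simp_all
  have bound: "prob (F p) \<le> exp (- cell_const / 2 * (n / real m ^ d)) ^ m" if p: "p \<in> W" for p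
  proof -
    have "real m / 2 \<le> card (set p)"
      using p by (simp add: W_def)
    then have "m / 2 * cell_const / real m ^ d \<le> card (set p) * cell_const / real m ^ d"
      using cell_const_pos by (intro divide_right_mono mult_right_mono) auto
    also have "\<dots> \<le> measure uniform_sphere (A p)"
      unfolding A_def using p m by (intro measure_cells_ge) (auto simp: W_def walks_def)
    finally have ge: "m / 2 * cell_const / real m ^ d \<le> measure uniform_sphere (A p)" .
    have "prob (F p) \<le> exp (- measure uniform_sphere (A p)) ^ n"
      unfolding F using exp_ge_add_one_self[of "- measure uniform_sphere (A p)"]
      by (intro power_mono) auto
    also have "\<dots> \<le> exp (- (m / 2 * cell_const / real m ^ d)) ^ n"
      using ge by (intro power_mono) auto
    also have "\<dots> = exp (- cell_const / 2 * (n / real m ^ d)) ^ m"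
      by (simp flip: exp_of_nat_mult add: mult_ac)
    finally show ?thesis .
  qed
  have "space ?M - G \<subseteq> (\<Union>p\<in>W. F p)"
  proof
    fix X assume X: "X \<in> space ?M - G"
    then have "\<not> d < chromatic_number {1..n} (borsuk_edges n \<alpha> X)"
      by (simp add: G_def)
    then obtain f where f: "proper_colouring {1..n} (borsuk_edges n \<alpha> X) d f"
      using chromatic_number_gt[OF finite_atLeastAtMost singleton_notin_borsuk_edges] by blast
    have "X i \<in> sphere 0 1" if "i \<in> {1..n}" for i
      using X that by (auto simp: space_iid_sphere PiE_iff)
    then obtain p where "p \<in> walks d m m" "m \<le> 2 * card (set p)"
      "\<And>i. i \<in> {1..n} \<Longrightarrow> X i \<notin> (\<Union>v\<in>set p. cell m v)"
      using colouring_imp_empty_walk[OF m d _ \<alpha> f] by metis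
    then show "X \<in> (\<Union>p\<in>W. F p)"
      using X by (intro UN_I[of p]) (auto simp: W_def F_def A_def)
  qed
  then have "prob (space ?M - G) \<le> prob (\<Union>p\<in>W. F p)"
    using F cardW by (intro finite_measure_mono) auto
  also have "\<dots> \<le> (\<Sum>p\<in>W. prob (F p))"
    using F cardW by (intro finite_measure_subadditive_finite) auto
  also have "\<dots> \<le> (\<Sum>p\<in>W. exp (- cell_const / 2 * (n / real m ^ d)) ^ m)"
    by (intro sum_mono bound)
  also have "\<dots> = card W * exp (- cell_const / 2 * (n / real m ^ d)) ^ m"
    by simp
  also have "\<dots> \<le> real ((2 * m + 1) ^ (d + 1) * (2 * 3 ^ (d + 1)) ^ m) * exp (- cell_const / 2 * (n / real m ^ d)) ^ m"
    using cardW(2) by (intro mult_right_mono) (simp_all only: of_nat_le_iff zero_le_power exp_ge_zero)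
  also have "\<dots> = (2 * real m + 1) ^ (d + 1) * (2 * 3 ^ (d + 1) * exp (- cell_const / 2 * (n / real m ^ d))) ^ m"
    by (simp only: of_nat_mult of_nat_power of_nat_add of_nat_numeral of_nat_1 power_mult_distrib mult.assoc)
  finally have le: "prob (space ?M - G) \<le> \<dots>" .
  have "G \<in> events"
    unfolding G_def using \<alpha> by (intro sets_chromatic_number_gt) auto
  then have "prob (space ?M - G) = 1 - prob G"
    by (rule prob_compl)
  then show ?thesis
    using le unfolding G_def[symmetric] by linarith
qed

end

section \<open>Choice of constants and the limit\<close>

lemma eventually_cos_le: "eventually (\<lambda>a::real. cos a \<le> 1 - a\<^sup>2 / 4) (at_right 0)"
  by real_asymp

lemma polynomial_times_half_power_tendsto_0:
  "(\<lambda>m::nat. (2 * real m + 1) ^ k * (1 / 2) ^ m) \<longlonglongrightarrow> 0"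
  by real_asymp

theorem theorem1:
  fixes d :: nat
  assumes "d \<ge> 2" and "CARD('n::finite) = d + 1"
  shows "\<exists>c::real. c > 0 \<and>
    (\<lambda>n. \<P>(X in (iid_sphere n :: (nat \<Rightarrow> real ^ 'n) measure).
            chromatic_number {1..n} (borsuk_edges n (c * real n powr (- 1 / real d)) X) > d))
      \<longlonglongrightarrow> 1"
proof -
  have "card {..d} = card (Basis :: (real ^ 'n) set)"
    using assms(2) by simp
  then obtain e :: "nat \<Rightarrow> real ^ 'n" where "bij_betw e {..d} Basis"
    using finite_same_card_bij[of "{..d}" "Basis :: (real ^ 'n) set"] by auto
  then interpret indexed_basis d e by unfold_locales
  \<comment> \<open>Makes the exponential factor half the reciprocal of the branching factor
    \<open>2 * 3 ^ (d + 1)\<close>, so the base in \<open>prob_colourable_le\<close> is at most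
    1/2.\<close>
  define M where "M = 2 * ln (4 * 3 ^ (d + 1)) / cell_const"
  have "1 < (4 * 3 ^ (d + 1) :: real)"
    by (rule less_le_trans[of _ "4 * 1"]) (auto simp del: power_Suc)
  then have M: "0 < M" 
    unfolding M_def using cell_const_pos by (intro divide_pos_pos mult_pos_pos) auto
  have expM: "exp (- cell_const / 2 * M) = 1 / (4 * 3 ^ (d + 1))"
    using cell_const_pos by (simp add: M_def exp_minus field_simps)
  \<comment> \<open>With 12, \<alpha>^2 / 4 becomes 36 (d + 1) / y^2, just above the 32 (d + 1) /
    y^2 that bounds the closeness term after rounding y down to m.\<close>
  define c where "c = 12 * sqrt (d + 1) * M powr (1 / d)"
  \<comment> \<open>Solves n / y^d = M; rounding down keeps n / m^d at least
    \<open>M\<close>.\<close>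
  define y where "y n = (real n / M) powr (1 / d)" for n
  define m where "m n = nat \<lfloor>y n\<rfloor>" for n
  define \<alpha> where "\<alpha> n = c * real n powr (- 1 / real d)" for n
  define b where "b k = (2 * real k + 1) ^ (d + 1) * (1 / 2) ^ k" for k :: nat
  have c: "0 < c" using M by (simp add: c_def add_nonneg_pos)
  have d: "0 < d" using assms(1) by simp
  have y: "filterlim y at_top sequentially"
    unfolding y_def using M d by real_asymp
  have \<alpha>_y: "\<alpha> n = 12 * sqrt (d + 1) / y n" if "0 < n" for n
    using that M by (simp add: \<alpha>_def c_def y_def powr_divide powr_minus_divide)
  have "filterlim \<alpha> (at_right 0) sequentially"
    unfolding \<alpha>_def using c d by real_asymp
  then have cos: "eventually (\<lambda>n. cos (\<alpha> n) \<le> 1 - (\<alpha> n)\<^sup>2 / 4) sequentially"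
    and \<alpha>: "eventually (\<lambda>n. \<alpha> n \<in> {0<..<pi}) sequentially"
    using eventually_compose_filterlim[OF eventually_cos_le]
      eventually_compose_filterlim[OF eventually_at_right_real[OF pi_gt_zero]] by blast+
  have mlim: "filterlim m at_top sequentially"
    unfolding m_def
    by (intro filterlim_compose[OF filterlim_nat_sequentially] filterlim_compose[OF filterlim_floor_sequentially] y)
  have lower: "eventually (\<lambda>n. 1 - b (m n) \<le> \<P>(X in (iid_sphere n :: (nat \<Rightarrow> real ^ 'n) measure).
      d < chromatic_number {1..n} (borsuk_edges n (\<alpha> n) X))) sequentially"
    using cos \<alpha> eventually_gt_at_top[of 0] filterlim_at_top[THEN iffD1, OF y, rule_format, of 1]
  proof eventually_elim
    case (elim n)
    have "real (m n) = of_int \<lfloor>y n\<rfloor>" "1 \<le> \<lfloor>y n\<rfloor>"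
      using elim(4) by (simp_all add: m_def le_floor_iff)
    \<comment> \<open>From 1 on, rounding down loses at most a factor 2.\<close>
    then have m: "y n / 2 \<le> m n" "m n \<le> y n" "0 < m n"
      by linarith+
    have "real (m n) ^ d \<le> y n ^ d"
      using m by (intro power_mono) auto
    also have "y n ^ d = n / M"
      using elim(3) M d by (simp add: y_def powr_power)
    finally have "M \<le> n / real (m n) ^ d"
      using m M by (simp add: field_simps)
    then have "exp (- cell_const / 2 * (n / real (m n) ^ d)) \<le> exp (- cell_const / 2 * M)"
      using mult_left_mono[of M "n / real (m n) ^ d" "cell_const / 2"] cell_const_pos by simp
    then have "2 * 3 ^ (d + 1) * exp (- cell_const / 2 * (n / real (m n) ^ d)) \<le> 1 / 2"
      unfolding expM by (simp add: field_simps)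
    then have "(2 * real (m n) + 1) ^ (d + 1) * (2 * 3 ^ (d + 1) * exp (- cell_const / 2 * (n / real (m n) ^ d))) ^ m n \<le> b (m n)"
      unfolding b_def by (intro mult_mono power_mono) auto
    moreover have "8 * (d + 1) / (real (m n))\<^sup>2 < 1 - cos (\<alpha> n)"
    proof -
      have "8 * (d + 1) / (real (m n))\<^sup>2 \<le> 8 * (d + 1) / (y n / 2)\<^sup>2"
        using m elim(4) by (intro divide_left_mono power_mono) auto
      also have "\<dots> = 32 * (d + 1) / (y n)\<^sup>2"
        by (simp add: power_divide)
      also have "\<dots> < 36 * (d + 1) / (y n)\<^sup>2"
        using elim(4) by (intro divide_strict_right_mono) auto
      also have "\<dots> = (\<alpha> n)\<^sup>2 / 4"
        using elim(4) by (simp add: \<alpha>_y[OF elim(3)] power_divide power_mult_distrib field_simps)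
      finally show ?thesis using elim(1) by linarith
    qed
    ultimately show ?case
      using prob_colourable_le[of "m n" "\<alpha> n" n] m(3) d elim(2) by simp
  qed
  have lower_lim: "(\<lambda>n. 1 - b (m n)) \<longlonglongrightarrow> 1"
    unfolding b_def
    using tendsto_diff[OF tendsto_const[of "1::real"]
        filterlim_compose[OF polynomial_times_half_power_tendsto_0[of "d + 1"] mlim]]
    by (simp only: diff_zero)
  have "(\<lambda>n. \<P>(X in (iid_sphere n :: (nat \<Rightarrow> real ^ 'n) measure).
      d < chromatic_number {1..n} (borsuk_edges n (\<alpha> n) X))) \<longlonglongrightarrow> 1"
  proof (rule tendsto_sandwich[OF lower _ lower_lim])
    show "eventually (\<lambda>n. \<P>(X in (iid_sphere n :: (nat \<Rightarrow> real ^ 'n) measure).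
        d < chromatic_number {1..n} (borsuk_edges n (\<alpha> n) X)) \<le> 1) sequentially"
      using prob_space.prob_le_1[OF prob_space_iid_sphere] by (rule always_eventually[OF allI])
  qed (rule tendsto_const)
  then show ?thesis
    unfolding \<alpha>_def using c by blast
qed

end
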